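(* Let $d\ge 1$ be an integer and let $\mathcal{A}=\mathcal{M}(d,\mathbb{H}^2)=\mathcal{M}(d,\mathbb{H})\times\mathcal{M}(d,\mathbb{H})$, with unit $(\mathbf{1},\mathbf{1})$ and $\omega=(\mathbf{1},-\mathbf{1})$. Then the square roots of $(-\mathbf{1},-\mathbf{1})$ in $\mathcal{A}$ constitute a unique conjugacy class, which is a connected submanifold of dimension $4d^2=\dim_{\mathbb{R}}(\mathcal{A})/2$, and $\mathrm{Scal}(f,f')=\mathrm{Spec}(f,f')=0$ for every square root $(f,f')$ of $(-\mathbf{1},-\mathbf{1})$. Moreover the group $\mathrm{Aut}(\mathcal{A})$ has two connected components: the neutral component is $\mathrm{Inn}(\mathcal{A})$, and the other component contains the swap automorphism $(f,f')\mapsto(f',f)$.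
   Context: $\mathbb{H}$ denotes the quaternions and $\mathbf{1}$ the unit matrix of $\mathcal{M}(d,\mathbb{H})$. $\mathrm{Aut}(\mathcal{A})$ is the group of all automorphisms of the real algebra $\mathcal{A}$, and $\mathrm{Inn}(\mathcal{A})$ is its subgroup of inner automorphisms $x\mapsto a^{-1}xa$ with $a\in\mathcal{A}$ invertible. Conjugacy classes are the orbits of $\mathrm{Inn}(\mathcal{A})$ in $\mathcal{A}$. All objects carry their usual (finite-dimensional real) topology; the neutral component is the one containing the identity. The center $\mathrm{Z}(\mathcal{A})$ is spanned over $\mathbb{R}$ by $(\mathbf{1},\mathbf{1})$ and $\omega$, and $\mathcal{A}=\mathrm{Z}(\mathcal{A})\oplus[\mathcal{A},\mathcal{A}]$, where $[\mathcal{A},\mathcal{A}]$ is the real span of all commutators. The linear forms $\mathrm{Scal},\mathrm{Spec}:\mathcal{A}\to\mathbb{R}$ are defined by: $\mathrm{Scal}(x)(\mathbf{1},\mathbf{1})+\mathrm{Spec}(x)\,\omega$ is the projection of $x$ onto $\mathrm{Z}(\mathcal{A})$ along $[\mathcal{A},\mathcal{A}]$. *)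

theory Defs
  imports "HOL-Analysis.Analysis"
begin

section \<open>The real division algebra of quaternions\<close>

datatype quat = Quat (qre: real) (qi: real) (qj: real) (qk: real)

lemma quat_eq_iff: "x = y \<longleftrightarrow> qre x = qre y \<and> qi x = qi y \<and> qj x = qj y \<and> qk x = qk y"
  by (cases x; cases y) simp

instantiation quat :: ab_group_add
begin

definition "0 = Quat 0 0 0 0"
definition "x + y = Quat (qre x + qre y) (qi x + qi y) (qj x + qj y) (qk x + qk y)"
definition "- x = Quat (- qre x) (- qi x) (- qj x) (- qk x)"
definition "x - y = Quat (qre x - qre y) (qi x - qi y) (qj x - qj y) (qk x - qk y)"

instance
  by standard (simp_all add: quat_eq_iff zero_quat_def plus_quat_def uminus_quat_def minus_quat_def)

end

lemma quat_sel_zero [simp]: "qre 0 = 0" "qi 0 = 0" "qj 0 = 0" "qk 0 = 0"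
  by (simp_all add: zero_quat_def)

lemma quat_sel_plus [simp]:
  "qre (x + y) = qre x + qre y" "qi (x + y) = qi x + qi y"
  "qj (x + y) = qj x + qj y" "qk (x + y) = qk x + qk y"
  by (simp_all add: plus_quat_def)

lemma quat_sel_uminus [simp]:
  "qre (- x) = - qre x" "qi (- x) = - qi x" "qj (- x) = - qj x" "qk (- x) = - qk x"
  by (simp_all add: uminus_quat_def)

lemma quat_sel_minus [simp]:
  "qre (x - y) = qre x - qre y" "qi (x - y) = qi x - qi y"
  "qj (x - y) = qj x - qj y" "qk (x - y) = qk x - qk y"
  by (simp_all add: minus_quat_def)

instantiation quat :: real_vector
begin

definition "r *\<^sub>R x = Quat (r * qre x) (r * qi x) (r * qj x) (r * qk x)"

instance
  by standard (simp_all add: quat_eq_iff scaleR_quat_def algebra_simps)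

end

lemma quat_sel_scaleR [simp]:
  "qre (r *\<^sub>R x) = r * qre x" "qi (r *\<^sub>R x) = r * qi x"
  "qj (r *\<^sub>R x) = r * qj x" "qk (r *\<^sub>R x) = r * qk x"
  by (simp_all add: scaleR_quat_def)

text \<open>Multiplication: bilinear with \<open>i\<^sup>2 = j\<^sup>2 = k\<^sup>2 = ijk = -1\<close>.\<close>

instantiation quat :: real_algebra_1
begin

definition "1 = Quat 1 0 0 0"
definition "x * y = Quat
  (qre x * qre y - qi x * qi y - qj x * qj y - qk x * qk y)
  (qre x * qi y + qi x * qre y + qj x * qk y - qk x * qj y)
  (qre x * qj y - qi x * qk y + qj x * qre y + qk x * qi y)
  (qre x * qk y + qi x * qj y - qj x * qi y + qk x * qre y)"

instance
  by standard (simp_all add: quat_eq_iff one_quat_def times_quat_def algebra_simps)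

end

lemma quat_sel_one [simp]: "qre 1 = 1" "qi 1 = 0" "qj 1 = 0" "qk 1 = 0"
  by (simp_all add: one_quat_def)

lemma quat_sel_times [simp]:
  "qre (x * y) = qre x * qre y - qi x * qi y - qj x * qj y - qk x * qk y"
  "qi (x * y) = qre x * qi y + qi x * qre y + qj x * qk y - qk x * qj y"
  "qj (x * y) = qre x * qj y - qi x * qk y + qj x * qre y + qk x * qi y"
  "qk (x * y) = qre x * qk y + qi x * qj y - qj x * qi y + qk x * qre y"
  by (simp_all add: times_quat_def)

definition qcnj :: "quat \<Rightarrow> quat" where
  "qcnj x = Quat (qre x) (- qi x) (- qj x) (- qk x)"

definition qnormsq :: "quat \<Rightarrow> real" where
  "qnormsq x = (qre x)\<^sup>2 + (qi x)\<^sup>2 + (qj x)\<^sup>2 + (qk x)\<^sup>2"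

lemma qnormsq_ge_zero: "0 \<le> qnormsq x"
  by (simp add: qnormsq_def)

lemma qnormsq_eq_zero_iff: "qnormsq x = 0 \<longleftrightarrow> x = 0"
  by (auto simp: qnormsq_def quat_eq_iff add_nonneg_eq_0_iff)

lemma qcnj_times: "qcnj x * x = qnormsq x *\<^sub>R 1" "x * qcnj x = qnormsq x *\<^sub>R 1"
  by (simp_all add: quat_eq_iff qcnj_def qnormsq_def power2_eq_square)

lemma qnormsq_times: "qnormsq (x * y) = qnormsq x * qnormsq y"
  by (simp add: qnormsq_def power2_eq_square algebra_simps)

instantiation quat :: real_div_algebra
begin

definition "inverse x = (1 / qnormsq x) *\<^sub>R qcnj x"
definition "x div y = x * inverse y" for x y :: quat

instance
proof
  fix x y :: quat
  show "inverse x * x = 1" if "x \<noteq> 0"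
    using that unfolding inverse_quat_def
    by (simp only: mult_scaleR_left qcnj_times scaleR_scaleR) (simp add: qnormsq_eq_zero_iff)
  show "x * inverse x = 1" if "x \<noteq> 0"
    using that unfolding inverse_quat_def
    by (simp only: mult_scaleR_right qcnj_times scaleR_scaleR) (simp add: qnormsq_eq_zero_iff)
  show "x div y = x * inverse y"
    by (rule divide_quat_def)
  show "inverse 0 = (0 :: quat)"
    by (simp only: inverse_quat_def qnormsq_eq_zero_iff [THEN iffD2, OF refl] div_by_0 scaleR_zero_left)
qed

end

instantiation quat :: real_inner
begin

definition "inner x y = qre x * qre y + qi x * qi y + qj x * qj y + qk x * qk y"
definition "norm (x :: quat) = sqrt (inner x x)"
definition "sgn (x :: quat) = x /\<^sub>R norm x"
definition "dist (x :: quat) y = norm (x - y)"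
definition [code del]:
  "(uniformity :: (quat \<times> quat) filter) = (INF e\<in>{0 <..}. principal {(x, y). dist x y < e})"
definition [code del]:
  "open (U :: quat set) \<longleftrightarrow> (\<forall>x\<in>U. eventually (\<lambda>(x', y). x' = x \<longrightarrow> y \<in> U) uniformity)"

instance
proof
  fix x y z :: quat and r :: real
  show "0 \<le> inner x x"
    by (simp add: inner_quat_def)
  show "inner x x = 0 \<longleftrightarrow> x = 0"
    using qnormsq_eq_zero_iff [of x] by (simp add: inner_quat_def qnormsq_def power2_eq_square)
qed (simp_all add: inner_quat_def norm_quat_def sgn_quat_def dist_quat_def uniformity_quat_def
      open_quat_def algebra_simps)

end

instance quat :: real_normed_div_algebra
proof
  fix x y :: quat
  have "norm z = sqrt (qnormsq z)" for z :: quat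
    by (simp add: norm_quat_def inner_quat_def qnormsq_def power2_eq_square)
  then show "norm (x * y) = norm x * norm y"
    by (simp add: qnormsq_times real_sqrt_mult)
qed

instantiation quat :: euclidean_space
begin

definition "Basis = {Quat 1 0 0 0, Quat 0 1 0 0, Quat 0 0 1 0, Quat 0 0 0 1}"

instance
proof
  show "(Basis :: quat set) \<noteq> {}" "finite (Basis :: quat set)"
    by (simp_all add: Basis_quat_def)
  show "inner u v = (if u = v then 1 else 0)" if "u \<in> Basis" "v \<in> Basis" for u v :: quat
    using that unfolding Basis_quat_def insert_iff empty_iff
    by (elim disjE) (simp_all add: inner_quat_def)
  show "(\<forall>u\<in>Basis. inner x u = 0) \<longleftrightarrow> x = 0" for x :: quat
    by (simp add: Basis_quat_def inner_quat_def quat_eq_iff [of x 0])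
qed

end

lemma DIM_quat [simp]: "DIM(quat) = 4"
  by (simp add: Basis_quat_def)


section \<open>The algebra \<open>\<M>(d, \<H>) \<times> \<M>(d, \<H>)\<close>, where \<open>d = CARD('n)\<close>\<close>

text \<open>
  The library's \<open>*\<close> and \<open>1\<close> on the type of vectors are componentwise, hence they are not the ones
  of the matrix algebra: the latter are \<open>**\<close> and \<open>mat 1\<close>.
\<close>

type_synonym 'n hmat = "quat ^ 'n ^ 'n"
type_synonym 'n alg = "'n hmat \<times> 'n hmat"

definition alg_mult :: "'n::finite alg \<Rightarrow> 'n alg \<Rightarrow> 'n alg" (infixl \<open>\<odot>\<close> 70) where
  "x \<odot> y = (fst x ** fst y, snd x ** snd y)"

definition alg_one :: "'n::finite alg" where
  "alg_one = (mat 1, mat 1)"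

definition alg_omega :: "'n::finite alg" where
  "alg_omega = (mat 1, - mat 1)"

definition sqrts_minus_one :: "'n::finite alg set" where
  "sqrts_minus_one = {x. x \<odot> x = - alg_one}"

text \<open>
  Linear endomorphisms of a finite-dimensional space are automatically bounded, and the usual
  topology on them is that of the operator norm on the type of bounded linear maps.
\<close>

definition Aut :: "('n::finite alg \<Rightarrow>\<^sub>L 'n alg) set" where
  "Aut = {T. bij (blinfun_apply T) \<and> blinfun_apply T alg_one = alg_one \<and>
             (\<forall>x y. blinfun_apply T (x \<odot> y) = blinfun_apply T x \<odot> blinfun_apply T y)}"

definition Inn :: "('n::finite alg \<Rightarrow>\<^sub>L 'n alg) set" where
  "Inn = {T. \<exists>a b. a \<odot> b = alg_one \<and> b \<odot> a = alg_one \<and>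
             (\<forall>x. blinfun_apply T x = b \<odot> x \<odot> a)}"

definition conjugacy_classes :: "'n::finite alg set set" where
  "conjugacy_classes = range (\<lambda>x. (\<lambda>T. blinfun_apply T x) ` Inn)"

definition alg_center :: "'n::finite alg set" where
  "alg_center = {z. \<forall>x. z \<odot> x = x \<odot> z}"

definition alg_commutators :: "'n::finite alg set" where
  "alg_commutators = span {x \<odot> y - y \<odot> x | x y. True}"

text \<open>
  The descriptions below are proper because \<open>\<A>\<close> is the direct sum of its center and
  \<open>[\<A>, \<A>]\<close>, and because the unit and \<open>\<omega>\<close> form a basis of the center.
\<close>

definition center_proj :: "'n::finite alg \<Rightarrow> 'n alg" where
  "center_proj x = (THE z. z \<in> alg_center \<and> x - z \<in> alg_commutators)"

definition Scal :: "'n::finite alg \<Rightarrow> real" where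
  "Scal x = (THE s. \<exists>t. center_proj x = s *\<^sub>R alg_one + t *\<^sub>R alg_omega)"

definition Spec :: "'n::finite alg \<Rightarrow> real" where
  "Spec x = (THE t. \<exists>s. center_proj x = s *\<^sub>R alg_one + t *\<^sub>R alg_omega)"


section \<open>Smooth submanifolds of a Euclidean space\<close>

text \<open>
  \<open>C_diff k U f\<close> is meant for open \<open>U\<close>: \<open>f\<close> is of class \<open>C\<^sup>k\<close> on \<open>U\<close>. In a
  finite-dimensional space, the derivative is of class \<open>C\<^sup>k\<close> iff all directional derivatives are.
\<close>

primrec C_diff ::
  "nat \<Rightarrow> 'a::euclidean_space set \<Rightarrow> ('a \<Rightarrow> 'b::euclidean_space) \<Rightarrow> bool" where
  "C_diff 0 U f \<longleftrightarrow> continuous_on U f"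
| "C_diff (Suc k) U f \<longleftrightarrow> (\<forall>x\<in>U. f differentiable (at x)) \<and>
     (\<forall>v. C_diff k U (\<lambda>x. frechet_derivative f (at x) v))"

definition smooth_on :: "'a::euclidean_space set \<Rightarrow> ('a \<Rightarrow> 'b::euclidean_space) \<Rightarrow> bool" where
  "smooth_on U f \<longleftrightarrow> (\<forall>k. C_diff k U f)"

text \<open>
  Embedded submanifolds of constant dimension \<open>m\<close>: around each point, some diffeomorphism \<open>\<phi>\<close>
  (with inverse \<open>\<psi>\<close>) of open sets of the ambient space straightens \<open>S\<close> to an
  \<open>m\<close>-dimensional linear subspace.
\<close>

definition smooth_submanifold :: "nat \<Rightarrow> 'a::euclidean_space set \<Rightarrow> bool" where
  "smooth_submanifold m S \<longleftrightarrow>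
     (\<forall>p\<in>S. \<exists>U V \<phi> \<psi> (W :: 'a set).
        open U \<and> p \<in> U \<and> open V \<and> homeomorphism U V \<phi> \<psi> \<and> smooth_on U \<phi> \<and> smooth_on V \<psi> \<and>
        subspace W \<and> dim W = m \<and> \<phi> ` (S \<inter> U) = V \<inter> W)"

end

theory Submission
  imports Defs
begin

text \<open>
  A square root \<open>f\<close> of \<open>- 1\<close> in \<open>\<M>(d, \<H>)\<close> is conjugate to \<open>i\<close>, because the vectors \<open>v\<close> with
  \<open>f v = v i\<close> span \<open>\<H>\<^sup>d\<close> over \<open>\<H>\<close> and hence contain a basis. The same exchange of columns, one at a
  time, shows that \<open>GL(d, \<H>)\<close> is connected; so are its images, the group of inner automorphisms and the
  conjugacy class. Around a square root \<open>p\<close>, a Cayley transform straightens the class to the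
  space of the elements that anticommute with \<open>p\<close>, which is half of the algebra. Square roots of
  \<open>- 1\<close> are commutators up to a factor (\<open>2 i = j k - k j\<close>), so that their projection to the center vanishes.
  Finally, a nonzero multiplicative linear map \<open>\<phi>\<close> from \<open>\<M>(d, \<H>)\<close> to itself is inner: averaging with
  the Casimir element of \<open>\<H>\<close> gives some \<open>P \<noteq> 0\<close> with \<open>\<phi>(X) P = P X\<close>, and the kernel of \<open>P\<close> is invariant
  under all \<open>X\<close>, hence trivial. Therefore an automorphism of the product is inner or the swap of an inner
  one, and the two kinds are told apart by the image of \<open>\<omega>\<close>.
\<close>

section \<open>Calculus of \<open>C\<^sup>k\<close> maps\<close>

lemma C_diff_SucI:
  assumes "\<And>x. x \<in> U \<Longrightarrow> (f has_derivative f' x) (at x)"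
    and "\<And>v. C_diff k U (\<lambda>x. frechet_derivative f (at x) v)"
  shows "C_diff (Suc k) U f"
  using assms by (auto intro: differentiableI)

text \<open>Since \<open>U\<close> is open, the derivative at a point of \<open>U\<close> depends
  only on values in \<open>U\<close>, so agreement on \<open>U\<close> passes to the derivatives of
  every order.\<close>

lemma C_diff_cong:
  assumes "open U"
  shows "(\<And>x. x \<in> U \<Longrightarrow> f x = g x) \<Longrightarrow> C_diff k U f \<Longrightarrow> C_diff k U g"
proof (induction k arbitrary: f g)
  case 0
  then show ?case by (simp cong: continuous_on_cong)
next
  case (Suc k)
  have d: "f differentiable at x" if "x \<in> U" for x
    using Suc.prems(2) that by simp
  have eq: "frechet_derivative f (at x) = frechet_derivative g (at x)" if "x \<in> U" for x
    by (rule frechet_derivative_transform_within_open [OF d [OF that] assms that Suc.prems(1)])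
  have "g differentiable at x" if "x \<in> U" for x
    using d [OF that] assms that Suc.prems(1)
    by (meson differentiable_def has_derivative_transform_within_open)
  moreover have "C_diff k U (\<lambda>x. frechet_derivative g (at x) v)" for v
    by (rule Suc.IH [of "\<lambda>x. frechet_derivative f (at x) v"]) (use eq Suc.prems(2) in auto)
  ultimately show ?case by simp
qed

text \<open>Trades \<open>frechet_derivative\<close> for an explicit formula valid on
  \<open>U\<close>; the product rule and the derivative of inversion enter in this form.\<close>

lemma C_diff_Suc_derivI:
  assumes "open U" and d: "\<And>x. x \<in> U \<Longrightarrow> (f has_derivative f' x) (at x)"
    and "\<And>v. C_diff k U (\<lambda>x. f' x v)"
  shows "C_diff (Suc k) U f"
proof (rule C_diff_SucI [OF d])
  fix v
  show "C_diff k U (\<lambda>x. frechet_derivative f (at x) v)"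
    by (rule C_diff_cong [OF assms(1) _ assms(3) [of v]]) (metis d frechet_derivative_at)
qed auto

lemma C_diff_SucD:
  assumes "C_diff (Suc k) U f"
  shows "x \<in> U \<Longrightarrow> (f has_derivative frechet_derivative f (at x)) (at x)"
    and "C_diff k U (\<lambda>x. frechet_derivative f (at x) v)"
  using assms by (simp_all add: frechet_derivative_works)

text \<open>\<open>C_diff (Suc k)\<close> speaks of derivatives only, so the induction descends
  through them until differentiability gives continuity.\<close>

lemma C_diff_Suc_imp: "C_diff (Suc k) U f \<Longrightarrow> C_diff k U f"
proof (induction k arbitrary: f)
  case 0
  then show ?case
    by (auto intro!: continuous_at_imp_continuous_on differentiable_imp_continuous_within)
next
  case (Suc k)
  show ?case
    by (rule C_diff_SucI [OF C_diff_SucD(1) [OF Suc.prems]])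
      (use Suc.IH [OF C_diff_SucD(2) [OF Suc.prems]] in auto)
qed

lemma C_diff_const: "open U \<Longrightarrow> C_diff k U (\<lambda>x. c)"
proof (induction k arbitrary: c)
  case (Suc k)
  then show ?case
    by (intro C_diff_Suc_derivI [where f' = "\<lambda>x v. 0"]) auto
qed simp

lemma C_diff_linear:
  assumes "open U" "bounded_linear L"
  shows "C_diff k U L"
proof (cases k)
  case 0
  then show ?thesis using assms by (simp add: linear_continuous_on)
next
  case (Suc m)
  show ?thesis unfolding Suc
    by (rule C_diff_Suc_derivI [where f' = "\<lambda>x. L"])
      (use assms in \<open>auto intro: bounded_linear_imp_has_derivative C_diff_const\<close>)
qed

lemma C_diff_add:
  assumes "open U"
  shows "C_diff k U f \<Longrightarrow> C_diff k U g \<Longrightarrow> C_diff k U (\<lambda>x. f x + g x)"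
proof (induction k arbitrary: f g)
  case 0
  then show ?case by (simp add: continuous_on_add)
next
  case (Suc k)
  show ?case
    by (rule C_diff_Suc_derivI [OF assms has_derivative_add
          [OF C_diff_SucD(1) [OF Suc.prems(1)] C_diff_SucD(1) [OF Suc.prems(2)]]])
      (use Suc.IH [OF C_diff_SucD(2) [OF Suc.prems(1)] C_diff_SucD(2) [OF Suc.prems(2)]] in auto)
qed

text \<open>Product rule. Undifferentiated factors remain beside the derivatives and are lowered
  from order \<open>Suc k\<close> to \<open>k\<close> before the induction hypothesis
  applies.\<close>

lemma C_diff_bilinear:
  assumes "open U" "bounded_bilinear B"
  shows "C_diff k U f \<Longrightarrow> C_diff k U g \<Longrightarrow> C_diff k U (\<lambda>x. B (f x) (g x))"
proof (induction k arbitrary: f g)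
  case 0
  then show ?case by (simp add: bounded_bilinear.continuous_on [OF assms(2)])
next
  case (Suc k)
  show ?case
  proof (rule C_diff_Suc_derivI [OF assms(1) bounded_bilinear.FDERIV
          [OF assms(2) C_diff_SucD(1) [OF Suc.prems(1)] C_diff_SucD(1) [OF Suc.prems(2)]]])
    fix v
    show "C_diff k U (\<lambda>x. B (f x) (frechet_derivative g (at x) v)
        + B (frechet_derivative f (at x) v) (g x))"
      using Suc.prems
      by (intro C_diff_add assms Suc.IH C_diff_Suc_imp [of k U f] C_diff_Suc_imp [of k U g]
          C_diff_SucD(2))
  qed auto
qed

section \<open>Finite-dimensional real algebras\<close>

text \<open>The product is a parameter because \<open>*\<close> on vectors is componentwise. The
  locale serves twice: for the matrix algebra and for its square.\<close>

locale fd_algebra = mul: bounded_bilinear mul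
  for mul :: "'a::euclidean_space \<Rightarrow> 'a \<Rightarrow> 'a" (infixl \<open>\<cdot>\<close> 70) +
  fixes e :: 'a
  assumes assoc: "(x \<cdot> y) \<cdot> z = x \<cdot> (y \<cdot> z)"
    and e_left [simp]: "e \<cdot> x = x"
    and e_right [simp]: "x \<cdot> e = x"
begin

section \<open>Units and inverses\<close>

definition inverses :: "'a \<Rightarrow> 'a \<Rightarrow> bool" where
  "inverses x y \<longleftrightarrow> x \<cdot> y = e \<and> y \<cdot> x = e"

definition units :: "'a set" where
  "units = {x. \<exists>y. inverses x y}"

text \<open>Unspecified outside of \<open>units\<close>.\<close>

definition inv_of :: "'a \<Rightarrow> 'a" where
  "inv_of x = (SOME y. inverses x y)"

lemma inverses_inv_of: "x \<in> units \<Longrightarrow> inverses x (inv_of x)"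
  unfolding units_def inv_of_def by (auto intro: someI)

lemma inv_of_right [simp]: "x \<in> units \<Longrightarrow> x \<cdot> inv_of x = e"
  and inv_of_left [simp]: "x \<in> units \<Longrightarrow> inv_of x \<cdot> x = e"
  using inverses_inv_of by (auto simp: inverses_def)

lemma inv_of_right_cancel [simp]: "x \<in> units \<Longrightarrow> x \<cdot> (inv_of x \<cdot> y) = y"
  and inv_of_left_cancel [simp]: "x \<in> units \<Longrightarrow> inv_of x \<cdot> (x \<cdot> y) = y"
  by (simp_all flip: assoc)

lemma inverses_unique: "inverses x y \<Longrightarrow> inverses x z \<Longrightarrow> y = z"
  unfolding inverses_def by (metis assoc e_left e_right)

lemma inv_of_eqI: "inverses x y \<Longrightarrow> inv_of x = y"
  using inverses_unique inverses_inv_of by (force simp: units_def)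

lemma unitsI: "inverses x y \<Longrightarrow> x \<in> units"
  by (auto simp: units_def)

lemma units_mult: "x \<in> units \<Longrightarrow> y \<in> units \<Longrightarrow> x \<cdot> y \<in> units"
  by (rule unitsI [of _ "inv_of y \<cdot> inv_of x"]) (simp add: inverses_def assoc)

text \<open>In finite dimension an injective left multiplication is surjective, which gives a right
  inverse \<open>y\<close>; cancelling \<open>x\<close> in
  \<open>x \<cdot> (y \<cdot> x - e) = 0\<close> makes it two-sided.\<close>

lemma units_if_injective:
  assumes "\<And>u. x \<cdot> u = 0 \<Longrightarrow> u = 0"
  shows "x \<in> units"
proof -
  have lin: "linear (\<lambda>u. x \<cdot> u)"
    by (rule bounded_linear.linear [OF mul.bounded_linear_right])
  have "inj (\<lambda>u. x \<cdot> u)"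
    using linear_injective_0 [OF lin] assms by blast
  then have "surj (\<lambda>u. x \<cdot> u)"
    by (rule linear_inj_imp_surj [OF lin])
  then obtain y where y: "x \<cdot> y = e"
    by (metis surjD)
  have "x \<cdot> (y \<cdot> x - e) = 0"
    by (simp add: mul.diff_right y flip: assoc)
  then have "y \<cdot> x = e"
    using assms by fastforce
  with y show ?thesis
    by (intro unitsI [of _ y]) (simp add: inverses_def)
qed

section \<open>Openness of the units, continuity and differentiability of inversion\<close>

lemma units_near:
  assumes x: "x \<in> units"
  shows "\<exists>d>0. \<forall>y. dist y x < d \<longrightarrow> y \<in> units \<and> norm (inv_of y) \<le> 2 * norm (inv_of x)"
proof -
  obtain K where K: "K > 0" "\<And>a b. norm (a \<cdot> b) \<le> norm a * norm b * K"
    using mul.pos_bounded by blast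
  define N where "N = norm (inv_of x) + 1"
  have N: "N > 0" "norm (inv_of x) \<le> N"
    by (auto simp: N_def add_nonneg_pos)
  \<comment> \<open>Chosen so that multiplication by \<open>y - x\<close> and by
    \<open>inv_of x\<close> together shrinks norms by the factor 1/2; the two occurrences of
    \<open>K\<close> pay for the two products.\<close>
  define d where "d = 1 / (2 * K * K * N)"
  have d: "d > 0"
    using K N by (simp add: d_def)
  have contr: "norm (inv_of x \<cdot> ((y - x) \<cdot> u)) \<le> norm u / 2"
    and contr': "norm (u \<cdot> ((y - x) \<cdot> inv_of x)) \<le> norm u / 2"
    if y: "dist y x < d" for y u
  proof -
    have *: "N * (norm (y - x) * norm u * K) * K \<le> norm u / 2"
    proof -
      have "norm (y - x) * (2 * K * K * N) \<le> 1"
        using y K N by (simp add: d_def dist_norm field_simps)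
      then have "norm (y - x) * (2 * K * K * N) * norm u \<le> 1 * norm u"
        by (intro mult_right_mono) auto
      then show ?thesis by (simp add: algebra_simps)
    qed
    have "norm (inv_of x \<cdot> ((y - x) \<cdot> u)) \<le> norm (inv_of x) * norm ((y - x) \<cdot> u) * K"
      by (rule K)
    also have "\<dots> \<le> N * (norm (y - x) * norm u * K) * K"
      using K N by (intro mult_mono mult_nonneg_nonneg) auto
    finally show "norm (inv_of x \<cdot> ((y - x) \<cdot> u)) \<le> norm u / 2"
      using * by linarith
    have "norm (u \<cdot> ((y - x) \<cdot> inv_of x)) \<le> norm u * norm ((y - x) \<cdot> inv_of x) * K"
      by (rule K)
    also have "\<dots> \<le> norm u * (norm (y - x) * N * K) * K"
      using K N by (intro mult_mono mult_nonneg_nonneg order_trans [OF K(2)]) auto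
    finally show "norm (u \<cdot> ((y - x) \<cdot> inv_of x)) \<le> norm u / 2"
      using * by (simp add: algebra_simps)
  qed
  show ?thesis
  proof (intro exI [of _ d] conjI allI impI d)
    fix y assume y: "dist y x < d"
    show yu: "y \<in> units"
    proof (rule units_if_injective)
      \<comment> \<open>If \<open>y\<close> kills \<open>u\<close>, the contraction sends
        \<open>u\<close> to \<open>- u\<close>, so \<open>norm u \<le> norm u / 2\<close>.\<close>
      fix u assume "y \<cdot> u = 0"
      then have "inv_of x \<cdot> ((y - x) \<cdot> u) = - u"
        using x by (simp add: mul.diff_left mul.minus_right)
      with contr [OF y, of u] show "u = 0" by simp
    qed
    have "inv_of y \<cdot> ((y - x) \<cdot> inv_of x) = inv_of x - inv_of y"
      using x yu by (simp add: mul.diff_left mul.diff_right)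
    with contr' [OF y, of "inv_of y"]
    have "norm (inv_of x - inv_of y) \<le> norm (inv_of y) / 2" by simp
    then show "norm (inv_of y) \<le> 2 * norm (inv_of x)"
      by norm
  qed
qed

lemma open_units: "open units"
  unfolding open_dist using units_near by blast

text \<open>The resolvent identity writes the difference of the inverses as a product with the
  factor \<open>y - x\<close>, and \<open>units_near\<close> bounds the other factors.\<close>

lemma isCont_inv_of:
  assumes x: "x \<in> units"
  shows "isCont inv_of x"
proof -
  obtain K where K: "K > 0" "\<And>a b. norm (a \<cdot> b) \<le> norm a * norm b * K"
    using mul.pos_bounded by blast
  obtain d where d: "d > 0" "\<And>y. dist y x < d \<Longrightarrow> y \<in> units"
      "\<And>y. dist y x < d \<Longrightarrow> norm (inv_of y) \<le> 2 * norm (inv_of x)"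
    using units_near [OF x] by blast
  define M where "M = norm (inv_of x)"
  have M: "0 \<le> M" by (simp add: M_def)
  have "norm (inv_of y - inv_of x) \<le> 2 * M * (norm (y - x) * M * K) * K"
    if y: "dist y x < d" for y
  proof -
    have "inv_of y - inv_of x = - (inv_of y \<cdot> ((y - x) \<cdot> inv_of x))"
      using x d(2) [OF y] by (simp add: mul.diff_left mul.diff_right)
    then have "norm (inv_of y - inv_of x) = norm (inv_of y \<cdot> ((y - x) \<cdot> inv_of x))"
      by (metis norm_minus_cancel)
    also have "\<dots> \<le> norm (inv_of y) * norm ((y - x) \<cdot> inv_of x) * K"
      by (rule K)
    also have "\<dots> \<le> 2 * M * (norm (y - x) * M * K) * K"
      using K M d(3) [OF y]
      by (intro mult_mono mult_nonneg_nonneg order_trans [OF K(2)]) (auto simp: M_def)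
    finally show ?thesis .
  qed
  then have ev: "\<forall>\<^sub>F y in at x. norm (inv_of y - inv_of x) \<le> 2 * M * (norm (y - x) * M * K) * K"
    using d(1) by (auto simp: eventually_at)
  have "((\<lambda>y. 2 * M * (norm (y - x) * M * K) * K) \<longlongrightarrow> 2 * M * (norm (x - x) * M * K) * K) (at x)"
    by (intro tendsto_intros)
  then have "((\<lambda>y. inv_of y - inv_of x) \<longlongrightarrow> 0) (at x)"
    by (intro Lim_null_comparison [OF ev]) simp
  then show ?thesis
    by (simp add: isCont_def LIM_zero_iff)
qed

lemma continuous_on_inv_of: "continuous_on units inv_of"
  by (simp add: continuous_at_imp_continuous_on isCont_inv_of)

lemma has_derivative_inv_of:
  assumes x: "x \<in> units"
  shows "(inv_of has_derivative (\<lambda>h. - (inv_of x \<cdot> h \<cdot> inv_of x))) (at x)"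
proof -
  obtain K where K: "K > 0" "\<And>a b. norm (a \<cdot> b) \<le> norm a * norm b * K"
    using mul.pos_bounded by blast
  obtain d where d: "d > 0" "\<And>y. dist y x < d \<Longrightarrow> y \<in> units"
    using units_near [OF x] by blast
  show ?thesis
  proof (rule has_derivativeI_sandwich [OF d(1)])
    show "bounded_linear (\<lambda>h. - (inv_of x \<cdot> h \<cdot> inv_of x))"
      by (intro bounded_linear_minus bounded_linear_compose [OF mul.bounded_linear_left]
          mul.bounded_linear_right)
    fix y assume y: "y \<noteq> x" "dist y x < d"
    \<comment> \<open>Using the resolvent identity once more, the remainder contains both
      \<open>y - x\<close> and the difference of the inverses; the latter tends to 0 by
      continuity.\<close>
    have "(inv_of y - inv_of x) - - (inv_of x \<cdot> (y - x) \<cdot> inv_of x)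
        = (inv_of x - inv_of y) \<cdot> ((y - x) \<cdot> inv_of x)"
      using x d(2) [OF y(2)] by (simp add: mul.diff_left mul.diff_right assoc)
    also have "norm \<dots> \<le> norm (inv_of x - inv_of y) * norm ((y - x) \<cdot> inv_of x) * K"
      by (rule K)
    also have "\<dots> \<le> norm (inv_of x - inv_of y) * (norm (y - x) * norm (inv_of x) * K) * K"
      using K by (intro mult_mono mult_nonneg_nonneg) auto
    finally show "norm ((inv_of y - inv_of x) - - (inv_of x \<cdot> (y - x) \<cdot> inv_of x)) / norm (y - x)
        \<le> norm (inv_of x - inv_of y) * (norm (inv_of x) * K) * K"
      using y by (simp add: field_simps)
  next
    have "((\<lambda>y. norm (inv_of x - inv_of y) * (norm (inv_of x) * K) * K) \<longlongrightarrow>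
        norm (inv_of x - inv_of x) * (norm (inv_of x) * K) * K) (at x)"
      using isCont_inv_of [OF x] by (intro tendsto_intros) (simp add: isCont_def)
    then show "((\<lambda>y. norm (inv_of x - inv_of y) * (norm (inv_of x) * K) * K) \<longlongrightarrow> 0) (at x)"
      by simp
  qed
qed

lemmas C_diff_mul = C_diff_bilinear [OF _ mul.bounded_bilinear_axioms]

text \<open>The derivative of inversion is a product of inverses and constants, so each order of
  differentiability yields the next.\<close>

lemma C_diff_inv_of_affine:
  assumes L: "bounded_linear L" and U: "open U" "\<And>x. x \<in> U \<Longrightarrow> e + L x \<in> units"
  shows "C_diff k U (\<lambda>x. inv_of (e + L x))"
proof (induction k)
  case 0
  have "continuous_on U (\<lambda>x. e + L x)"
    by (intro continuous_intros linear_continuous_on L)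
  then show ?case
    using U(2) by (auto intro: continuous_on_compose2 [OF continuous_on_inv_of])
next
  case (Suc k)
  have der: "((\<lambda>x. inv_of (e + L x)) has_derivative
      (\<lambda>h. - (inv_of (e + L x) \<cdot> L h \<cdot> inv_of (e + L x)))) (at x)" if "x \<in> U" for x
  proof -
    have "((\<lambda>x. e + L x) has_derivative L) (at x)"
      using has_derivative_add [OF has_derivative_const bounded_linear_imp_has_derivative [OF L]] by simp
    from has_derivative_compose [OF this has_derivative_inv_of [OF U(2) [OF that]]]
    show ?thesis .
  qed
  have C: "C_diff k U (\<lambda>x. - (inv_of (e + L x) \<cdot> L v \<cdot> inv_of (e + L x)))" for v
  proof -
    have "C_diff k U (\<lambda>x. inv_of (e + L x) \<cdot> - L v \<cdot> inv_of (e + L x))"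
      by (intro C_diff_mul Suc C_diff_const U(1))
    then show ?thesis by (simp add: mul.minus_left mul.minus_right)
  qed
  show ?case
    by (rule C_diff_Suc_derivI [OF U(1) der C])
qed

section \<open>The Cayley transform and the manifold of square roots\<close>

text \<open>
  The Cayley transform \<open>u \<mapsto> (1 - u)(1 + u)\<^sup>-\<^sup>1\<close> is its own inverse. If \<open>p\<^sup>2 = -1\<close> and \<open>w = p y\<close>,
  then \<open>y\<^sup>2 = -1\<close> amounts to \<open>y p = w\<^sup>-\<^sup>1\<close>, that is, to \<open>p u p\<^sup>-\<^sup>1 = - u\<close> for the Cayley transform \<open>u\<close> of
  \<open>- w\<close>. Hence \<open>y \<mapsto> u\<close> straightens the set of square roots of \<open>- 1\<close> around \<open>p\<close>.
\<close>

definition cayley :: "'a \<Rightarrow> 'a" where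
  "cayley u = (e - u) \<cdot> inv_of (e + u)"

lemma double_in_units: "2 *\<^sub>R e \<in> units"
  by (rule unitsI [of _ "(1/2) *\<^sub>R e"])
    (simp add: inverses_def mul.scaleR_left mul.scaleR_right)

lemma cayley_plus:
  assumes "e + u \<in> units"
  shows "(e + cayley u) \<cdot> (e + u) = 2 *\<^sub>R e" "(e - cayley u) \<cdot> (e + u) = 2 *\<^sub>R u"
  using assms
  by (simp_all add: cayley_def mul.add_left mul.diff_left assoc scaleR_2)

lemma
  assumes u: "e + u \<in> units"
  shows cayley_in_units: "e + cayley u \<in> units"
    and cayley_cayley: "cayley (cayley u) = u"
proof -
  define c where "c = (1/2) *\<^sub>R (e + u)"
  have 1: "(e + cayley u) \<cdot> c = e" "(e - cayley u) \<cdot> c = u"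
    using cayley_plus [OF u] by (simp_all add: c_def mul.scaleR_right)
  \<comment> \<open>A left and a right inverse of \<open>c\<close> coincide; hence \<open>c\<close>
    is a two-sided inverse of \<open>e + cayley u\<close>.\<close>
  have "c \<cdot> (2 *\<^sub>R inv_of (e + u)) = e"
    using u by (simp add: c_def mul.scaleR_right mul.scaleR_left)
  with 1 have "e + cayley u = 2 *\<^sub>R inv_of (e + u)"
    by (metis assoc e_left e_right)
  with 1 \<open>c \<cdot> _ = e\<close> have inv: "inverses (e + cayley u) c"
    by (simp add: inverses_def)
  then show "e + cayley u \<in> units" by (rule unitsI)
  show "cayley (cayley u) = u"
    using 1 by (simp add: cayley_def [of "cayley u"] inv_of_eqI [OF inv])
qed

lemma C_diff_cayley:
  assumes L: "bounded_linear L" and U: "open U" "\<And>x. x \<in> U \<Longrightarrow> e + L x \<in> units"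
  shows "C_diff k U (\<lambda>x. cayley (L x))"
proof -
  have "C_diff k U (\<lambda>x. (e + - L x) \<cdot> inv_of (e + L x))"
    by (intro C_diff_mul C_diff_add C_diff_const C_diff_linear bounded_linear_minus
        C_diff_inv_of_affine assms)
  then show ?thesis by (simp add: cayley_def)
qed

lemma smooth_submanifold_sqrts:
  assumes dim: "\<And>p. p \<cdot> p = - e \<Longrightarrow> dim {u. u \<cdot> p = - (p \<cdot> u)} = m"
  shows "smooth_submanifold m {x. x \<cdot> x = - e}"
  unfolding smooth_submanifold_def
proof
  fix p assume "p \<in> {x. x \<cdot> x = - e}"
  then have p: "p \<cdot> p = - e" by simp
  then have pp: "p \<cdot> (p \<cdot> x) = - x" for x
    by (simp add: mul.minus_left flip: assoc)
  define U where "U = {y. e + - (p \<cdot> y) \<in> units}"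
  define V where "V = {u. e + u \<in> units}"
  define \<phi> where "\<phi> y = cayley (- (p \<cdot> y))" for y
  define \<psi> where "\<psi> u = p \<cdot> cayley u" for u
  define W where "W = {u. u \<cdot> p = - (p \<cdot> u)}"
  have L: "bounded_linear (\<lambda>y. - (p \<cdot> y))"
    by (intro bounded_linear_minus mul.bounded_linear_right)
  have open_pre: "open {y. e + M y \<in> units}" if "bounded_linear M" for M
    using open_vimage [OF open_units, of "\<lambda>y. e + M y"] linear_continuous_on [OF that]
    by (simp add: vimage_def continuous_on_add)
  have openU: "open U" and openV: "open V"
    unfolding U_def V_def using open_pre [OF L] open_pre [OF bounded_linear_ident] by auto
  \<comment> \<open>At \<open>y = p\<close> the element \<open>e - p \<cdot> y\<close> is
    \<open>2 *\<^sub>R e\<close>.\<close>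
  have pU: "p \<in> U"
    using double_in_units by (simp add: U_def p scaleR_2)
  have smooth\<phi>: "smooth_on U \<phi>"
    unfolding smooth_on_def \<phi>_def
    by (intro allI C_diff_cayley L openU) (simp add: U_def)
  have smooth\<psi>: "smooth_on V \<psi>"
    unfolding smooth_on_def \<psi>_def
    by (intro allI C_diff_mul C_diff_const openV
        C_diff_cayley bounded_linear_ident) (simp add: V_def)
  have cont: "continuous_on U \<phi>" "continuous_on V \<psi>"
    using smooth\<phi> smooth\<psi> unfolding smooth_on_def by (metis C_diff.simps(1))+
  have \<phi>V: "\<phi> y \<in> V" "\<psi> (\<phi> y) = y" if "y \<in> U" for y
    using that by (auto simp: U_def V_def \<phi>_def \<psi>_def cayley_in_units cayley_cayley pp mul.minus_right)
  have \<psi>U: "\<psi> u \<in> U" "\<phi> (\<psi> u) = u" if "u \<in> V" for u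
    using that by (auto simp: U_def V_def \<phi>_def \<psi>_def cayley_in_units cayley_cayley pp)
  have homeo: "homeomorphism U V \<phi> \<psi>"
    by (rule homeomorphismI) (use cont \<phi>V \<psi>U in auto)
  have \<psi>S: "\<psi> u \<cdot> \<psi> u = - e" if u: "u \<in> V" "u \<in> W" for u
  proof -
    define c where "c = inv_of (e + u)"
    have c: "e + u \<in> units" "(e + u) \<cdot> c = e" "c \<cdot> (e + u) = e"
      using u by (auto simp: V_def c_def)
    \<comment> \<open>Moving \<open>p\<close> past \<open>e - u\<close> turns it into
      \<open>e + u\<close>; in the square of \<open>\<psi> u\<close> the inner
      \<open>c \<cdot> (e + u)\<close> then cancels and \<open>p \<cdot> p\<close> remains between
      inverse factors.\<close>
    have up: "(e + u) \<cdot> p = p \<cdot> (e - u)"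
      using u by (simp add: W_def mul.add_left mul.diff_right)
    have "\<psi> u = (e + u) \<cdot> p \<cdot> c"
      by (simp add: \<psi>_def cayley_def c_def up assoc)
    then have "\<psi> u \<cdot> \<psi> u = (e + u) \<cdot> (p \<cdot> ((c \<cdot> (e + u)) \<cdot> (p \<cdot> c)))"
      by (simp add: assoc)
    then show ?thesis
      by (simp add: c pp mul.minus_right)
  qed
  have \<phi>W: "\<phi> y \<in> W" if y: "y \<in> U" "y \<cdot> y = - e" for y
  proof -
    have yy: "y \<cdot> (y \<cdot> x) = - x" for x
      by (simp add: y mul.minus_left flip: assoc)
    define u where "u = \<phi> y"
    have eu: "e + - (p \<cdot> y) \<in> units"
      using y by (simp add: U_def)
    have 1: "u \<cdot> (e - p \<cdot> y) = e + p \<cdot> y"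
      using eu by (simp add: u_def \<phi>_def cayley_def assoc)
    \<comment> \<open>The element \<open>e - p \<cdot> y\<close> intertwines \<open>p\<close> with
      \<open>y\<close>. Thus \<open>u \<cdot> p\<close> and \<open>- (p \<cdot> u)\<close> agree
      after right multiplication by this unit.\<close>
    have 2: "p \<cdot> (e - p \<cdot> y) = (e - p \<cdot> y) \<cdot> y" "(e + p \<cdot> y) \<cdot> y = - (p \<cdot> (e + p \<cdot> y))"
      by (simp_all add: mul.diff_left mul.diff_right mul.add_left mul.add_right assoc y pp
          mul.minus_right)
    have "(u \<cdot> p) \<cdot> (e - p \<cdot> y) = (u \<cdot> (e - p \<cdot> y)) \<cdot> y"
      by (simp add: assoc 2)
    also have "\<dots> = (- (p \<cdot> u)) \<cdot> (e - p \<cdot> y)"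
      by (simp add: 1 2 mul.minus_left assoc)
    finally have "(u \<cdot> p) \<cdot> ((e - p \<cdot> y) \<cdot> inv_of (e - p \<cdot> y))
        = (- (p \<cdot> u)) \<cdot> ((e - p \<cdot> y) \<cdot> inv_of (e - p \<cdot> y))"
      by (simp flip: assoc)
    then show ?thesis
      using eu by (simp add: W_def u_def)
  qed
  have "\<phi> ` ({x. x \<cdot> x = - e} \<inter> U) = V \<inter> W"
  proof
    show "\<phi> ` ({x. x \<cdot> x = - e} \<inter> U) \<subseteq> V \<inter> W"
      using \<phi>V \<phi>W by auto
    show "V \<inter> W \<subseteq> \<phi> ` ({x. x \<cdot> x = - e} \<inter> U)"
    proof
      fix u assume "u \<in> V \<inter> W"
      then show "u \<in> \<phi> ` ({x. x \<cdot> x = - e} \<inter> U)"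
        using \<psi>U [of u] \<psi>S [of u] by (intro image_eqI [of _ _ "\<psi> u"]) auto
    qed
  qed
  moreover have "subspace W"
    unfolding W_def subspace_def
    by (auto simp: mul.zero_left mul.zero_right mul.add_left mul.add_right mul.scaleR_left
        mul.scaleR_right)
  moreover have "dim W = m"
    unfolding W_def by (rule dim [OF p])
  ultimately show "\<exists>U V \<phi> \<psi> (W :: 'a set). open U \<and> p \<in> U \<and> open V \<and> homeomorphism U V \<phi> \<psi> \<and>
      smooth_on U \<phi> \<and> smooth_on V \<psi> \<and> subspace W \<and> dim W = m \<and>
      \<phi> ` ({x. x \<cdot> x = - e} \<inter> U) = V \<inter> W"
    using openU openV pU homeo smooth\<phi> smooth\<psi>
    by (intro exI [of _ U] exI [of _ V] exI [of _ \<phi>] exI [of _ \<psi>] exI [of _ W]) simp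
qed

text \<open>Left multiplication by \<open>q\<close> exchanges the commutant of \<open>p\<close> with the space of the elements
  that anticommute with \<open>p\<close>.\<close>

lemma dim_anticommutant:
  assumes p: "p \<cdot> p = - e" and q: "q \<in> units" and qp: "q \<cdot> p = - (p \<cdot> q)"
  shows "2 * dim {u. u \<cdot> p = - (p \<cdot> u)} = DIM('a)"
proof -
  have pp: "p \<cdot> (p \<cdot> x) = - x" for x
    using p by (simp add: mul.minus_left flip: assoc)
  define C where "C = {u. u \<cdot> p = p \<cdot> u}"
  define D where "D = {u. u \<cdot> p = - (p \<cdot> u)}"
  have sub: "subspace C" "subspace D"
    unfolding C_def D_def subspace_def
    by (auto simp: mul.zero_left mul.zero_right mul.add_left mul.add_right mul.scaleR_left
        mul.scaleR_right)
  have q1: "q \<cdot> (p \<cdot> x) = - (p \<cdot> (q \<cdot> x))" for x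
    by (metis assoc mul.minus_left qp)
  have "D = (\<lambda>u. q \<cdot> u) ` C"
  proof
    show "(\<lambda>u. q \<cdot> u) ` C \<subseteq> D"
      by (auto simp: C_def D_def assoc q1)
    show "D \<subseteq> (\<lambda>u. q \<cdot> u) ` C"
    proof
      fix u assume u: "u \<in> D"
      have "q \<cdot> ((inv_of q \<cdot> u) \<cdot> p) = q \<cdot> (p \<cdot> (inv_of q \<cdot> u))"
        using u q by (simp add: D_def assoc q1)
      then have "inv_of q \<cdot> u \<cdot> p = p \<cdot> (inv_of q \<cdot> u)"
        using q by (metis inv_of_left_cancel)
      then show "u \<in> (\<lambda>u. q \<cdot> u) ` C"
        using q by (intro image_eqI [of _ _ "inv_of q \<cdot> u"]) (auto simp: C_def)
    qed
  qed
  moreover have "inj (\<lambda>u. q \<cdot> u)"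
    using q by (metis injI inv_of_left_cancel)
  ultimately have dimD: "dim D = dim C"
    using dim_image_eq [OF bounded_linear.linear [OF mul.bounded_linear_right]]
    by (metis inj_on_subset subset_UNIV)
  have "x \<in> {x + y |x y. x \<in> C \<and> y \<in> D}" for x
  proof -
    \<comment> \<open>Conjugation by \<open>p\<close> is the involution sending \<open>x\<close> to
      \<open>- (p \<cdot> x \<cdot> p)\<close>; these are the components of \<open>x\<close> for its
      eigenvalues 1 and -1.\<close>
    have "(1/2) *\<^sub>R (x - p \<cdot> x \<cdot> p) \<in> C" "(1/2) *\<^sub>R (x + p \<cdot> x \<cdot> p) \<in> D"
      by (simp_all add: C_def D_def mul.scaleR_left mul.scaleR_right mul.diff_left mul.add_left
          mul.diff_right mul.add_right assoc p pp mul.minus_left mul.minus_right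
          flip: scaleR_minus_right)
    moreover have "x = (1/2) *\<^sub>R (x - p \<cdot> x \<cdot> p) + (1/2) *\<^sub>R (x + p \<cdot> x \<cdot> p)"
      by (simp flip: scaleR_right_distrib)
    ultimately show ?thesis by blast
  qed
  then have "{x + y |x y. x \<in> C \<and> y \<in> D} = UNIV" by blast
  moreover have "C \<inter> D = {0}"
  proof -
    have "u = 0" if "u \<in> C" "u \<in> D" for u
    proof -
      have "p \<cdot> u = - (p \<cdot> u)"
        using that by (simp add: C_def D_def)
      then have "2 *\<^sub>R (p \<cdot> u) = 0"
        by (simp only: scaleR_2 eq_neg_iff_add_eq_0)
      then have "p \<cdot> u = 0"
        by simp
      then show "u = 0"
        using pp [of u] by (simp add: mul.zero_right)
    qed
    then show ?thesis using sub by (auto simp: subspace_0)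
  qed
  ultimately show ?thesis
    using dim_sums_Int [OF sub] dimD unfolding D_def [symmetric] by simp
qed

end

section \<open>Quaternionic matrices\<close>

lemma bounded_bilinear_matrix_mult:
  "bounded_bilinear ((**) :: 'n::finite hmat \<Rightarrow> 'n hmat \<Rightarrow> 'n hmat)"
  unfolding bilinear_conv_bounded_bilinear [symmetric] bilinear_def
  by (auto intro!: linearI simp: matrix_add_ldistrib vec_eq_iff matrix_matrix_mult_def
      algebra_simps sum.distrib scaleR_sum_right)

interpretation hmat: fd_algebra "(**) :: 'n::finite hmat \<Rightarrow> 'n hmat \<Rightarrow> 'n hmat" "mat 1"
  by (intro fd_algebra.intro fd_algebra_axioms.intro bounded_bilinear_matrix_mult)
    (simp_all add: matrix_mul_assoc)

lemma matrix_mult_nth: "(A ** B) $ a $ b = (\<Sum>c\<in>UNIV. A $ a $ c * B $ c $ b)"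
  by (simp add: matrix_matrix_mult_def)

lemma matrix_vector_mult_nth: "(A *v x) $ a = (\<Sum>c\<in>UNIV. A $ a $ c * x $ c)"
  by (simp add: matrix_vector_mult_def)

lemma column_matrix_mult: "column b (A ** B) = A *v column b B"
  by (simp add: vec_eq_iff column_def matrix_mult_nth matrix_vector_mult_nth)

lemma column_mat_one: "column k (mat 1) = axis k (1 :: quat)"
  by (simp add: vec_eq_iff column_def mat_def axis_def)

lemma hmat_units_if_ker:
  fixes P :: "'n::finite hmat"
  assumes "\<And>x. P *v x = 0 \<Longrightarrow> x = 0"
  shows "P \<in> hmat.units"
proof (rule hmat.units_if_injective)
  fix X assume X: "P ** X = 0"
  have "column b X = 0" for b
  proof (rule assms)
    have "P *v column b X = column b 0"
      using column_matrix_mult [of b P X] X by simp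
    then show "P *v column b X = 0"
      by (simp add: column_def vec_eq_iff)
  qed
  then show "X = 0"
    by (simp add: vec_eq_iff column_def)
qed

subsection \<open>Exchange of columns\<close>

definition replace_column :: "'n \<Rightarrow> quat ^ 'n \<Rightarrow> 'n::finite hmat \<Rightarrow> 'n hmat" where
  "replace_column k c P = (\<chi> a b. if b = k then c $ a else P $ a $ b)"

lemma column_replace_column: "column b (replace_column k c P) = (if b = k then c else column b P)"
  by (simp add: vec_eq_iff column_def replace_column_def)

lemma replace_column_self [simp]: "replace_column k (column k P) P = P"
  by (simp add: vec_eq_iff column_def replace_column_def)

lemma matrix_eq_columnI: "(\<And>b. column b P = column b Q) \<Longrightarrow> P = Q"
  by (simp add: vec_eq_iff column_def)

text \<open>Exchanging a column is right multiplication by an elementary matrix, whose column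
  \<open>k\<close> holds the coordinates of the new column with respect to those of
  \<open>P\<close>.\<close>

lemma mult_replace_column_one: "P ** replace_column k u (mat 1) = replace_column k (P *v u) P"
proof (rule matrix_eq_columnI)
  fix b
  have "P *v column b (mat 1) = column b P"
    by (simp flip: column_matrix_mult)
  then show "column b (P ** replace_column k u (mat 1)) = column b (replace_column k (P *v u) P)"
    by (simp add: column_matrix_mult column_replace_column)
qed

lemma replace_column_one_in_units:
  assumes u: "u $ k \<noteq> 0"
  shows "replace_column k u (mat 1) \<in> hmat.units"
proof (rule hmat_units_if_ker)
  fix x assume x: "replace_column k u (mat 1) *v x = 0"
  have "(replace_column k u (mat 1) *v x) $ a = (if a = k then 0 else x $ a) + u $ a * x $ k" for a
  proof -
    have "(replace_column k u (mat 1) *v x) $ a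
        = (\<Sum>c\<in>UNIV. (if c = a then if a = k then 0 else x $ a else 0)
            + (if c = k then u $ a * x $ k else 0))"
      unfolding matrix_vector_mult_nth
      by (rule sum.cong) (auto simp: replace_column_def mat_def)
    then show ?thesis by (simp add: sum.distrib)
  qed
  then have *: "(if a = k then 0 else x $ a) + u $ a * x $ k = 0" for a
    by (simp add: x)
  \<comment> \<open>Row \<open>k\<close> reads \<open>u $ k * x $ k = 0\<close>; the other rows then
    give the remaining entries.\<close>
  then have "x $ k = 0" using u *[of k] by simp
  then show "x = 0"
    using * by (metis (mono_tags) add.right_neutral mult_zero_right vec_eq_iff zero_index)
qed

text \<open>Steinitz exchange: \<open>c\<close> may replace column \<open>k\<close> of the basis
  \<open>P\<close> when its coordinate along that column is nonzero.\<close>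

lemma replace_column_in_units:
  assumes "P \<in> hmat.units" "(hmat.inv_of P *v c) $ k \<noteq> 0"
  shows "replace_column k c P \<in> hmat.units"
  using hmat.units_mult [OF assms(1) replace_column_one_in_units [OF assms(2)]] assms(1)
  by (simp add: mult_replace_column_one matrix_vector_mul_assoc)

lemma inv_of_mult_column:
  "P \<in> hmat.units \<Longrightarrow> hmat.inv_of P *v column k P = axis k 1"
  by (simp add: column_mat_one flip: column_matrix_mult)

text \<open>The punctured quaternions are connected, having real dimension 4; the other entries are
  free. The map \<open>F\<close> overwrites entry \<open>k\<close>.\<close>

lemma connected_nth_nonzero: "connected {u :: quat ^ 'n::finite. u $ k \<noteq> 0}"
proof -
  define F where "F = (\<lambda>(q, w :: quat ^ 'n). \<chi> a. if a = k then q else w $ a)"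
  have "continuous_on UNIV F"
    unfolding F_def case_prod_unfold
    by (rule continuous_on_vec_lambda, case_tac "a = k") (auto intro!: continuous_intros)
  then have "connected (F ` ((- {0}) \<times> UNIV))"
    by (intro connected_continuous_image connected_Times connected_punctured_universe)
      (auto intro: continuous_on_subset)
  moreover have "F ` ((- {0}) \<times> UNIV) = {u. u $ k \<noteq> 0}"
  proof
    show "{u. u $ k \<noteq> 0} \<subseteq> F ` ((- {0}) \<times> UNIV)"
      by (auto simp: F_def vec_eq_iff intro!: image_eqI [where x = "(u $ k, u)" for u])
  qed (auto simp: F_def)
  ultimately show ?thesis by simp
qed

text \<open>The admissible coordinate vectors \<open>u\<close> form a connected set; it contains
  \<open>axis k 1\<close>, which gives back \<open>P\<close>, and the coordinates of
  \<open>c\<close>.\<close>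

lemma connected_component_replace_column:
  assumes P: "P \<in> hmat.units" and c: "(hmat.inv_of P *v c) $ k \<noteq> 0"
  shows "connected_component hmat.units P (replace_column k c P)"
proof -
  define F where "F u = P ** replace_column k u (mat 1)" for u
  have "continuous_on UNIV (\<lambda>u. replace_column k u (mat 1 :: 'a hmat))"
    unfolding replace_column_def
    by (intro continuous_on_vec_lambda, case_tac "b = k") (auto intro!: continuous_intros)
  then have "continuous_on UNIV F"
    unfolding F_def by (intro hmat.mul.continuous_on continuous_on_const)
  then have "connected (F ` {u. u $ k \<noteq> 0})"
    by (intro connected_continuous_image connected_nth_nonzero) (auto intro: continuous_on_subset)
  moreover have "F ` {u. u $ k \<noteq> 0} \<subseteq> hmat.units"
    unfolding F_def using P hmat.units_mult replace_column_one_in_units by blast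
  moreover have "F (hmat.inv_of P *v c) = replace_column k c P"
    using P by (simp add: F_def mult_replace_column_one matrix_vector_mul_assoc)
  then have "replace_column k c P \<in> F ` {u. u $ k \<noteq> 0}"
    using c by (metis (mono_tags, lifting) image_eqI mem_Collect_eq)
  moreover have "F (axis k 1) = P"
    by (simp add: F_def mult_replace_column_one flip: column_mat_one column_matrix_mult)
  then have "P \<in> F ` {u. u $ k \<noteq> 0}"
    by (intro image_eqI [of _ _ "axis k 1"]) (auto simp: axis_def)
  ultimately show ?thesis
    unfolding connected_component_def by blast
qed

text \<open>Two invertible matrices that differ in the column \<open>k\<close> stay invertible when it is replaced in
  both by one and the same vector outside of two proper subspaces.\<close>

lemma connected_component_hmat_units:
  fixes S :: "'n::finite set"
  shows "P \<in> hmat.units \<Longrightarrow> Q \<in> hmat.units \<Longrightarrow> (\<And>b. b \<notin> S \<Longrightarrow> column b P = column b Q) \<Longrightarrow>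
    connected_component hmat.units P Q"
proof (induction S arbitrary: P Q rule: finite_induct [OF finite])
  case 1
  then have "P = Q" by (intro matrix_eq_columnI) auto
  with 1 show ?case by simp
next
  case (2 k S)
  define f g where "f c = (hmat.inv_of P *v c) $ k" and "g c = (hmat.inv_of Q *v c) $ k" for c
  have add: "f (c + c') = f c + f c'" "g (c + c') = g c + g c'" for c c'
    by (simp_all add: f_def g_def matrix_vector_right_distrib)
  have "f (column k P) = 1" "g (column k Q) = 1"
    using 2 by (simp_all add: f_def g_def inv_of_mult_column)
  \<comment> \<open>One of the two columns or their sum works: if \<open>g\<close> vanishes on the
    first and \<open>f\<close> on the second, both take the value 1 on the sum.\<close>
  then have "\<exists>c. f c \<noteq> 0 \<and> g c \<noteq> 0"
    using add [of "column k P" "column k Q"] by (metis add.left_neutral add.right_neutral zero_neq_one)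
  then obtain c where c: "(hmat.inv_of P *v c) $ k \<noteq> 0" "(hmat.inv_of Q *v c) $ k \<noteq> 0"
    by (auto simp: f_def g_def)
  have "connected_component hmat.units (replace_column k c P) (replace_column k c Q)"
    using 2 c by (intro 2) (auto simp: column_replace_column replace_column_in_units)
  moreover have "connected_component hmat.units P (replace_column k c P)"
    "connected_component hmat.units (replace_column k c Q) Q"
    using 2 c by (auto intro: connected_component_replace_column connected_component_sym)
  ultimately show ?case
    by (meson connected_component_trans)
qed

lemma connected_hmat_units: "connected (hmat.units :: 'n::finite hmat set)"
  unfolding connected_iff_connected_component
  using connected_component_hmat_units [of _ _ "UNIV :: 'n set"] by auto

text \<open>The rows of invertible matrices are the nonzero linear forms, so the hypothesis says
  that \<open>V\<close> spans. Starting from the unit matrix, columns are exchanged for elements of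
  \<open>V\<close> one at a time.\<close>

lemma units_columns_exchange:
  fixes V :: "(quat ^ 'n::finite) set" and S :: "'n set"
  assumes V: "\<And>g k. g \<in> hmat.units \<Longrightarrow> \<exists>v\<in>V. (g *v v) $ k \<noteq> 0"
  shows "\<exists>P\<in>hmat.units. \<forall>b\<in>S. column b P \<in> V"
proof (induction S rule: finite_induct [OF finite])
  case 1
  have "mat 1 \<in> hmat.units"
    by (rule hmat.unitsI [of _ "mat 1"]) (simp add: hmat.inverses_def)
  then show ?case by auto
next
  case (2 k S)
  then obtain P where P: "P \<in> hmat.units" "\<forall>b\<in>S. column b P \<in> V" by blast
  have "hmat.inv_of P \<in> hmat.units"
    using P by (intro hmat.unitsI [of _ P]) (simp add: hmat.inverses_def)
  with V obtain v where "v \<in> V" "(hmat.inv_of P *v v) $ k \<noteq> 0" by blast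
  with P show ?case
    by (intro bexI [of _ "replace_column k v P"])
      (auto simp: column_replace_column replace_column_in_units)
qed

subsection \<open>Square roots of \<open>- 1\<close>\<close>

abbreviation qI :: quat where "qI \<equiv> Quat 0 1 0 0"
abbreviation qJ :: quat where "qJ \<equiv> Quat 0 0 1 0"
abbreviation qK :: quat where "qK \<equiv> Quat 0 0 0 1"

lemma mat_mult_mat: "mat p ** mat q = (mat (p * q) :: 'n::finite hmat)"
proof -
  have "(\<Sum>c\<in>UNIV. (if a = c then p else 0) * (if c = b then q else 0))
      = (\<Sum>c\<in>UNIV. if c = a then if a = b then p * q else 0 else 0)" for a b :: 'n
    by (rule sum.cong) auto
  then show ?thesis by (simp add: vec_eq_iff matrix_mult_nth mat_def)
qed

lemma mult_mat_nth: "(P ** mat q) $ a $ b = P $ a $ b * q"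
proof -
  have "(\<Sum>c\<in>UNIV. P $ a $ c * (if c = b then q else 0))
      = (\<Sum>c\<in>UNIV. if c = b then P $ a $ b * q else 0)"
    by (rule sum.cong) auto
  then show ?thesis by (simp add: matrix_mult_nth mat_def)
qed

lemma uminus_mat: "- mat q = (mat (- q) :: 'n::finite hmat)"
  by (simp add: vec_eq_iff mat_def)

text \<open>The vectors \<open>v\<close> with \<open>f v = v i\<close> span the right vector space \<open>\<H>\<^sup>d\<close>, because \<open>x - f(x) i\<close> is such
  a vector, and so is \<open>(x + f(x) i) j\<close>.\<close>

lemma sqrt_conjugate_mat_qI:
  fixes f :: "'n::finite hmat"
  assumes f: "f ** f = - mat 1"
  shows "\<exists>P\<in>hmat.units. f ** P = P ** mat qI"
proof -
  \<comment> \<open>Scalars act on the right, so that they commute with matrices.\<close>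
  define rm :: "quat \<Rightarrow> quat ^ 'n \<Rightarrow> quat ^ 'n" where "rm q x = (\<chi> a. x $ a * q)" for q x
  have rm: "A *v rm q x = rm q (A *v x)" for A q x
    by (simp add: vec_eq_iff rm_def matrix_vector_mult_nth sum_distrib_right mult.assoc)
  have rm_rm: "rm p (rm q x) = rm (q * p) x" for p q x
    by (simp add: vec_eq_iff rm_def mult.assoc)
  have rm_add: "rm p (x + y) = rm p x + rm p y" and rm_diff: "rm p (x - y) = rm p x - rm p y"
    and rm_minus: "rm p (- x) = - rm p x" and minus_rm: "rm (- p) x = - rm p x" for p x y
    by (simp_all add: vec_eq_iff rm_def algebra_simps)
  have rm1: "rm 1 x = x" for x
    by (simp add: vec_eq_iff rm_def)
  define V where "V = {v. f *v v = rm qI v}"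
  have ff: "f *v (f *v x) = - x" for x
    unfolding matrix_vector_mul_assoc f
    by (simp add: vec_eq_iff matrix_vector_mult_nth mat_def sum_negf if_distrib [of "\<lambda>t. t * _"]
        cong: if_cong)
  have q: "qI * qI = - 1" "qI * qJ = - (qJ * qI)"
    by (simp_all add: quat_eq_iff)
  have V1: "x - rm qI (f *v x) \<in> V" and V2: "rm qJ (x + rm qI (f *v x)) \<in> V" for x
    by (simp_all add: V_def rm matrix_vector_right_distrib matrix_vector_mult_diff_distrib ff
        rm_add rm_diff rm_rm rm_minus minus_rm q mult.assoc)
       (simp_all add: q minus_rm rm1 flip: rm_rm)
  have "\<exists>v\<in>V. (g *v v) $ k \<noteq> 0" if g: "g \<in> hmat.units" for g k
  proof (rule ccontr)
    assume *: "\<not> (\<exists>v\<in>V. (g *v v) $ k \<noteq> 0)"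
    \<comment> \<open>A form vanishing on \<open>V\<close> kills \<open>x - f(x) i\<close> and,
      after cancelling \<open>qJ\<close>, also \<open>x + f(x) i\<close>; these sum to
      \<open>2 x\<close>.\<close>
    have g0: "(g *v x) $ k = 0" for x
    proof -
      have "(g *v (x - rm qI (f *v x))) $ k = 0"
        using * V1 [of x] by blast
      moreover have "(g *v (x + rm qI (f *v x))) $ k * qJ = (g *v rm qJ (x + rm qI (f *v x))) $ k"
        unfolding rm by (simp add: rm_def)
      then have "(g *v (x + rm qI (f *v x))) $ k * qJ = 0"
        using * V2 [of x] by auto
      then have "(g *v (x + rm qI (f *v x))) $ k = 0"
        by (simp add: quat_eq_iff)
      ultimately have "(g *v x) $ k + (g *v x) $ k = 0"
        by (simp add: matrix_vector_right_distrib matrix_vector_mult_diff_distrib)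
      then show ?thesis
        by (simp flip: scaleR_2)
    qed
    have "g *v (hmat.inv_of g *v axis k 1) = axis k 1"
      using g by (simp add: matrix_vector_mul_assoc)
    then show False
      using g0 by (metis axis_nth zero_neq_one)
  qed
  from units_columns_exchange [of V UNIV, OF this]
  obtain P where P: "P \<in> hmat.units" "\<And>b. column b P \<in> V" by blast
  have "f ** P = P ** mat qI"
  proof (rule matrix_eq_columnI)
    fix b
    have "column b (f ** P) = rm qI (column b P)"
      using P(2) [of b] by (simp add: V_def column_matrix_mult)
    then show "column b (f ** P) = column b (P ** mat qI)"
      by (simp add: vec_eq_iff column_def rm_def mult_mat_nth)
  qed
  with P show ?thesis by blast
qed

subsection \<open>Endomorphisms are inner\<close>

definition munit :: "'n::finite \<Rightarrow> 'n \<Rightarrow> quat \<Rightarrow> 'n hmat" where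
  "munit a b q = (\<chi> r s. if r = a \<and> s = b then q else 0)"

lemma munit_mult_nth: "(X ** munit a b q) $ r $ s = (if s = b then X $ r $ a * q else 0)"
proof -
  have "(X ** munit a b q) $ r $ s = (\<Sum>t\<in>UNIV. if t = a then if s = b then X $ r $ a * q else 0 else 0)"
    unfolding matrix_mult_nth by (rule sum.cong) (auto simp: munit_def)
  then show ?thesis by simp
qed

lemma munit_mult: "munit a b p ** munit c d q = (if b = c then munit a d (p * q) else 0)"
proof -
  have "(munit a b p ** munit c d q) $ r $ s = (if b = c then munit a d (p * q) else 0) $ r $ s" for r s
    unfolding munit_mult_nth by (auto simp: munit_def)
  then show ?thesis by (simp add: vec_eq_iff)
qed

lemma munit_decomp: "X = (\<Sum>a\<in>UNIV. \<Sum>b\<in>UNIV. munit a b (X $ a $ b))"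
proof -
  have "(\<Sum>a\<in>UNIV. \<Sum>b\<in>UNIV. munit a b (X $ a $ b) $ r $ s) = X $ r $ s" for r s
  proof -
    have "(\<Sum>b\<in>UNIV. munit a b (X $ a $ b) $ r $ s) = (if a = r then X $ r $ s else 0)" for a
    proof -
      have "(\<Sum>b\<in>UNIV. munit a b (X $ a $ b) $ r $ s)
          = (\<Sum>b\<in>UNIV. if b = s then if a = r then X $ r $ s else 0 else 0)"
        by (rule sum.cong) (auto simp: munit_def)
      then show ?thesis by simp
    qed
    then show ?thesis by simp
  qed
  then show ?thesis by (simp add: vec_eq_iff)
qed

lemma linear_munit: "linear (munit a b)"
  by (rule linearI) (simp_all add: vec_eq_iff munit_def)

lemma quat_units_mult:
  "qI * qI = - 1" "qJ * qJ = - 1" "qK * qK = - 1"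
  "qI * qJ = qK" "qJ * qK = qI" "qK * qI = qJ" "qJ * qI = - qK" "qK * qJ = - qI" "qI * qK = - qJ"
  by (simp_all add: quat_eq_iff)

text \<open>The Casimir element \<open>\<Sum> q \<otimes> q\<^sup>*\<close> of the quaternions, where \<open>q\<close> ranges over \<open>1, i, j, k\<close>.\<close>

definition casimir :: "(quat \<Rightarrow> quat \<Rightarrow> 'a) \<Rightarrow> 'a::real_vector" where
  "casimir B = B 1 1 - B qI qI - B qJ qJ - B qK qK"

text \<open>Both sides are linear in \<open>r\<close>, and for \<open>r = 1, i, j, k\<close>
  multiplication permutes the four terms up to sign.\<close>

lemma casimir_commute:
  fixes B :: "quat \<Rightarrow> quat \<Rightarrow> 'a::euclidean_space"
  assumes B: "bilinear B"
  shows "casimir (\<lambda>x y. B (r * x) y) = casimir (\<lambda>x y. B x (y * r))"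
proof -
  interpret B: bounded_bilinear B
    using B by (simp add: bilinear_conv_bounded_bilinear)
  have "linear (\<lambda>r. casimir (\<lambda>x y. B (r * x) y))" "linear (\<lambda>r. casimir (\<lambda>x y. B x (y * r)))"
    by (auto intro!: linearI simp: casimir_def distrib_left distrib_right B.add_left B.add_right
        B.scaleR_left B.scaleR_right scaleR_diff_right simp del: mult_1_left)
  moreover have "casimir (\<lambda>x y. B (b * x) y) = casimir (\<lambda>x y. B x (y * b))" if "b \<in> Basis" for b
  proof -
    from that consider "b = 1" | "b = qI" | "b = qJ" | "b = qK"
      by (auto simp: Basis_quat_def one_quat_def)
    then show ?thesis
      by cases (simp_all add: casimir_def quat_units_mult B.minus_left B.minus_right)
  qed
  ultimately have "(\<lambda>r. casimir (\<lambda>x y. B (r * x) y)) = (\<lambda>r. casimir (\<lambda>x y. B x (y * r)))"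
    by (rule linear_eq_stdbasis)
  then show ?thesis
    by (rule fun_cong)
qed

text \<open>The maps \<open>s \<mapsto> a * s * b\<close> make the tensor square of the quaternions
  act faithfully, so the coefficients of the independent right factors vanish; a basis of values of
  \<open>s\<close> detects this.\<close>

lemma casimir_eq_zeroD:
  assumes "\<And>s. casimir (\<lambda>x y. m x * s * y) = (0 :: quat)"
  shows "m 1 = 0"
  using assms [of 1] assms [of qI] assms [of qJ] assms [of qK]
  by (simp add: casimir_def quat_eq_iff)

lemma hmat_endomorphism_inner:
  fixes \<phi> :: "'n::finite hmat \<Rightarrow> 'n hmat"
  assumes lin: "linear \<phi>" and mult: "\<And>X Y. \<phi> (X ** Y) = \<phi> X ** \<phi> Y" and one: "\<phi> (mat 1) \<noteq> 0"
  shows "\<exists>P\<in>hmat.units. \<forall>X. \<phi> X = P ** X ** hmat.inv_of P"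
proof -
  have \<phi>_decomp: "\<phi> X = (\<Sum>a\<in>UNIV. \<Sum>b\<in>UNIV. \<phi> (munit a b (X $ a $ b)))" for X
    by (subst munit_decomp) (simp add: linear_sum [OF lin])
  have "\<exists>m. \<phi> (munit m m 1) \<noteq> 0"
  proof (rule ccontr)
    assume *: "\<not> (\<exists>m. \<phi> (munit m m 1) \<noteq> 0)"
    have "\<phi> (munit a b q) = 0" for a b q
    proof -
      \<comment> \<open>Each \<open>munit a b q\<close> has the left factor
        \<open>munit a a 1\<close>, so \<open>\<phi>\<close> would vanish on all matrix
        units.\<close>
      have "\<phi> (munit a a 1 ** munit a b q) = 0"
        using * unfolding mult by (simp add: hmat.mul.zero_left)
      then show ?thesis by (simp add: munit_mult)
    qed
    then have "\<phi> (mat 1) = 0"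
      by (subst \<phi>_decomp) simp
    with one show False by simp
  qed
  then obtain m where m: "\<phi> (munit m m 1) \<noteq> 0" by blast
  define B where "B Y a b x y = \<phi> (munit a m x) ** Y ** munit m b y" for Y a b x y
  \<comment> \<open>\<open>P Y\<close> averages \<open>\<phi>(u) ** Y ** u'\<close> over the Casimir
    element of the matrix algebra, built from matrix units and that of the quaternions.\<close>
  define P where "P Y = (\<Sum>a\<in>UNIV. casimir (B Y a a))" for Y
  have bil: "bilinear (B Y a b)" for Y a b
    using lin linear_munit [of a m] linear_munit [of m b]
    by (auto simp: bilinear_def B_def linear_iff hmat.mul.add_left hmat.mul.add_right
        hmat.mul.scaleR_left hmat.mul.scaleR_right)
  have left: "\<phi> (munit b c r) ** P Y = casimir (\<lambda>x y. B Y b c (r * x) y)" for b c r Y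
  proof -
    have "\<phi> (munit b c r) ** casimir (B Y a a)
        = (if a = c then casimir (\<lambda>x y. B Y b c (r * x) y) else 0)" for a
    proof -
      have "\<phi> (munit b c r) ** B Y a a x y = \<phi> (munit b c r ** munit a m x) ** Y ** munit m a y"
        for x y
        by (simp add: B_def mult hmat.assoc)
      then have "\<phi> (munit b c r) ** B Y a a x y = (if a = c then B Y b c (r * x) y else 0)" for x y
        by (simp add: munit_mult B_def linear_0 [OF lin] hmat.mul.zero_left)
      then show ?thesis
        by (simp add: casimir_def hmat.mul.diff_right)
    qed
    then show ?thesis
      by (simp add: P_def hmat.mul.sum_right)
  qed
  have right: "P Y ** munit b c r = casimir (\<lambda>x y. B Y b c x (y * r))" for b c r Y
  proof -
    have "casimir (B Y a a) ** munit b c r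
        = (if a = b then casimir (\<lambda>x y. B Y b c x (y * r)) else 0)" for a
    proof -
      have "B Y a a x y ** munit b c r = \<phi> (munit a m x) ** Y ** (munit m a y ** munit b c r)"
        for x y
        by (simp add: B_def hmat.assoc)
      then have "B Y a a x y ** munit b c r = (if a = b then B Y b c x (y * r) else 0)" for x y
        by (simp add: munit_mult B_def hmat.mul.zero_right)
      then show ?thesis
        by (simp add: casimir_def hmat.mul.diff_left)
    qed
    then show ?thesis
      by (simp add: P_def hmat.mul.sum_left)
  qed
  have comm: "\<phi> X ** P Y = P Y ** X" for X Y
  proof -
    have "\<phi> X ** P Y = (\<Sum>b\<in>UNIV. \<Sum>c\<in>UNIV. \<phi> (munit b c (X $ b $ c)) ** P Y)"
      by (subst \<phi>_decomp) (simp add: hmat.mul.sum_left)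
    also have "\<dots> = (\<Sum>b\<in>UNIV. \<Sum>c\<in>UNIV. P Y ** munit b c (X $ b $ c))"
      by (simp only: left right casimir_commute [OF bil])
    also have "\<dots> = P Y ** X"
      by (subst (2) munit_decomp) (simp only: hmat.mul.sum_right)
    finally show ?thesis .
  qed
  have "\<exists>Y. P Y \<noteq> 0"
  proof (rule ccontr)
    assume *: "\<not> (\<exists>Y. P Y \<noteq> 0)"
    have "\<phi> (munit m m 1) $ c $ b = 0" for b c
    proof (rule casimir_eq_zeroD)
      fix s
      \<comment> \<open>With \<open>Y = munit b m s\<close>, entry \<open>(c, m)\<close> isolates
        entry \<open>(c, b)\<close> of \<open>\<phi> (munit m m x)\<close>. The factor
        \<open>y * 1\<close> matches \<open>right\<close> for \<open>r = 1\<close>.\<close>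
      have "B (munit b m s) m m x (y * 1) $ c $ m = \<phi> (munit m m x) $ c $ b * s * y" for x y
        by (simp add: B_def munit_mult_nth)
      moreover have "casimir (\<lambda>x y. B (munit b m s) m m x (y * 1)) $ c $ m = 0"
        using * by (simp only: hmat.mul.zero_left zero_index flip: right) (simp add: hmat.mul.zero_left)
      ultimately show "casimir (\<lambda>x y. \<phi> (munit m m x) $ c $ b * s * y) = 0"
        by (simp add: casimir_def)
    qed
    with m show False by (simp add: vec_eq_iff)
  qed
  then obtain Y where Y: "P Y \<noteq> 0" by blast
  have P: "P Y \<in> hmat.units"
  proof (rule hmat_units_if_ker, rule ccontr)
    fix x assume x: "P Y *v x = 0" "x \<noteq> 0"
    then obtain a where a: "x $ a \<noteq> 0" by (auto simp: vec_eq_iff)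
    have "P Y *v z = 0" for z
    proof -
      \<comment> \<open>This matrix of rank at most one sends \<open>x\<close> to \<open>z\<close>,
        so a nonzero kernel vector would put every \<open>z\<close> in the kernel.\<close>
      define X :: "'n hmat" where "X = (\<chi> r s. if s = a then z $ r * inverse (x $ a) else 0)"
      have "(X *v x) $ r = z $ r" for r
      proof -
        have "(X *v x) $ r = (\<Sum>s\<in>UNIV. if s = a then z $ r else 0)"
          unfolding matrix_vector_mult_nth X_def
          by (rule sum.cong) (auto simp: a mult.assoc)
        then show ?thesis by simp
      qed
      then have "X *v x = z" by (simp add: vec_eq_iff)
      then have "P Y *v z = (P Y ** X) *v x"
        by (simp flip: matrix_vector_mul_assoc)
      also have "\<dots> = \<phi> X *v (P Y *v x)"
        by (simp add: matrix_vector_mul_assoc flip: comm)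
      finally show ?thesis
        by (simp add: x vec_eq_iff matrix_vector_mult_nth)
    qed
    then have "column b (P Y ** mat 1) = column b 0" for b
      unfolding column_matrix_mult by (simp add: column_def vec_eq_iff)
    with Y show False
      using matrix_eq_columnI [of "P Y" 0] by simp
  qed
  have "\<phi> X = P Y ** X ** hmat.inv_of (P Y)" for X
  proof -
    have "P Y ** X ** hmat.inv_of (P Y) = \<phi> X ** (P Y ** hmat.inv_of (P Y))"
      by (simp only: comm [symmetric] hmat.assoc)
    with P show ?thesis by simp
  qed
  with P show ?thesis by blast
qed

subsection \<open>Center and trace\<close>

lemma hmat_center:
  fixes Z :: "'n::finite hmat"
  assumes "\<And>X. Z ** X = X ** Z"
  shows "\<exists>s. Z = s *\<^sub>R mat 1"
proof -
  have comm: "(Z ** munit a b q) $ r $ s = (munit a b q ** Z) $ r $ s" for a b q r s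
    by (simp add: assms)
  have left: "(munit a b q ** Z) $ r $ s = (if r = a then q * Z $ b $ s else 0)" for a b q r s
  proof -
    have "(munit a b q ** Z) $ r $ s = (\<Sum>t\<in>UNIV. if t = b then if r = a then q * Z $ b $ s else 0 else 0)"
      unfolding matrix_mult_nth by (rule sum.cong) (auto simp: munit_def)
    then show ?thesis by simp
  qed
  have diag: "Z $ a $ a * q = q * Z $ b $ b" for a b q
    using comm [of a b q a b] by (simp add: left munit_mult_nth)
  have off: "Z $ b $ a = 0" if "a \<noteq> b" for a b
    using comm [of a a 1 b a] that by (simp add: left munit_mult_nth)
  \<comment> \<open>Any index would do, since \<open>diag\<close> with \<open>q = 1\<close> makes
    all diagonal entries equal.\<close>
  define z where "z = Z $ undefined $ undefined"
  have eq: "Z $ a $ a = z" for a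
    using diag [of a 1 undefined] by (simp add: z_def)
  have "z * qI = qI * z" "z * qJ = qJ * z"
    using diag [of undefined _ undefined] by (simp_all only: z_def)
  then have "z = qre z *\<^sub>R 1"
    by (simp add: quat_eq_iff)
  then have "Z = qre z *\<^sub>R mat 1"
    using eq off by (auto simp: vec_eq_iff mat_def)
  then show ?thesis by blast
qed

text \<open>The real part is taken because \<open>qre (x * y) = qre (y * x)\<close>, whereas the
  quaternionic trace need not vanish on commutators.\<close>

definition retrace :: "'n::finite hmat \<Rightarrow> real" where
  "retrace X = (\<Sum>a\<in>UNIV. qre (X $ a $ a))"

lemma linear_retrace: "linear retrace"
  by (rule linearI) (simp_all add: retrace_def sum.distrib sum_distrib_left)

lemma qre_sum: "qre (sum f A) = (\<Sum>a\<in>A. qre (f a))"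
  by (induction A rule: infinite_finite_induct) auto

lemma retrace_mult_commute: "retrace (X ** Y) = retrace (Y ** X)"
proof -
  have "retrace (X ** Y) = (\<Sum>a\<in>UNIV. \<Sum>b\<in>UNIV. qre (X $ a $ b * Y $ b $ a))"
    by (simp only: retrace_def matrix_mult_nth qre_sum)
  also have "\<dots> = (\<Sum>b\<in>UNIV. \<Sum>a\<in>UNIV. qre (Y $ b $ a * X $ a $ b))"
    by (subst sum.swap) (simp only: quat_sel_times mult.commute)
  also have "\<dots> = retrace (Y ** X)"
    by (simp only: retrace_def matrix_mult_nth qre_sum)
  finally show ?thesis .
qed

section \<open>The algebra \<open>\<M>(d, \<H>) \<times> \<M>(d, \<H>)\<close>\<close>

lemma bounded_bilinear_alg_mult:
  "bounded_bilinear ((\<odot>) :: 'n::finite alg \<Rightarrow> 'n alg \<Rightarrow> 'n alg)"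
  unfolding bilinear_conv_bounded_bilinear [symmetric] bilinear_def
  by (auto intro!: linearI simp: alg_mult_def hmat.mul.add_left hmat.mul.add_right
      hmat.mul.scaleR_left hmat.mul.scaleR_right prod_eq_iff)

interpretation alg: fd_algebra "(\<odot>) :: 'n::finite alg \<Rightarrow> 'n alg \<Rightarrow> 'n alg" alg_one
  by (intro fd_algebra.intro fd_algebra_axioms.intro bounded_bilinear_alg_mult)
    (simp_all add: alg_mult_def alg_one_def hmat.assoc)

lemma alg_inverses_iff:
  "alg.inverses x y \<longleftrightarrow> hmat.inverses (fst x) (fst y) \<and> hmat.inverses (snd x) (snd y)"
  unfolding alg.inverses_def hmat.inverses_def by (auto simp: alg_mult_def alg_one_def)

lemma alg_units_eq: "alg.units = hmat.units \<times> hmat.units"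
  by (fastforce simp: alg.units_def hmat.units_def alg_inverses_iff)

section \<open>Inner automorphisms\<close>

definition conjugation :: "'n::finite alg \<Rightarrow> 'n alg \<Rightarrow>\<^sub>L 'n alg" where
  "conjugation a = Blinfun (\<lambda>x. alg.inv_of a \<odot> x \<odot> a)"

lemma conjugation_apply: "blinfun_apply (conjugation a) x = alg.inv_of a \<odot> x \<odot> a"
  unfolding conjugation_def
  by (subst bounded_linear_Blinfun_apply)
    (auto intro: bounded_linear_compose [OF alg.mul.bounded_linear_left alg.mul.bounded_linear_right])

lemma Inn_eq: "Inn = conjugation ` (alg.units :: 'n::finite alg set)"
proof
  show "conjugation ` (alg.units :: 'n alg set) \<subseteq> Inn"
    unfolding Inn_def using alg.inv_of_right alg.inv_of_left conjugation_apply by blast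
  show "Inn \<subseteq> conjugation ` (alg.units :: 'n alg set)"
  proof
    fix T :: "'n alg \<Rightarrow>\<^sub>L 'n alg" assume "T \<in> Inn"
    then obtain a b where ab: "alg.inverses a b" and T: "\<And>x. blinfun_apply T x = b \<odot> x \<odot> a"
      by (auto simp: Inn_def alg.inverses_def)
    from ab have "T = conjugation a"
      by (intro blinfun_eqI) (simp add: T conjugation_apply alg.inv_of_eqI)
    with ab show "T \<in> conjugation ` alg.units"
      by (auto intro: alg.unitsI)
  qed
qed

lemma connected_Inn: "connected (Inn :: ('n::finite alg \<Rightarrow>\<^sub>L 'n alg) set)"
proof -
  have "continuous_on alg.units (conjugation :: 'n alg \<Rightarrow> _)"
    by (intro continuous_on_blinfun_componentwise)
      (auto simp: conjugation_apply intro!: alg.mul.continuous_on alg.continuous_on_inv_of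
        continuous_on_const continuous_on_id)
  moreover have "connected (alg.units :: 'n alg set)"
    by (simp add: alg_units_eq connected_Times connected_hmat_units)
  ultimately show ?thesis
    unfolding Inn_eq by (rule connected_continuous_image)
qed

lemma id_in_Inn: "id_blinfun \<in> Inn"
  unfolding Inn_def by (intro CollectI exI [of _ alg_one]) simp

lemma Inn_subset_Aut: "Inn \<subseteq> Aut"
proof
  fix T :: "'a alg \<Rightarrow>\<^sub>L 'a alg" assume "T \<in> Inn"
  then obtain a where a: "a \<in> alg.units" and T: "T = conjugation a"
    by (auto simp: Inn_eq)
  have "bij (blinfun_apply T)"
    by (rule o_bij [where g = "\<lambda>x. a \<odot> x \<odot> alg.inv_of a"])
      (use a in \<open>auto simp: fun_eq_iff T conjugation_apply alg.assoc\<close>)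
  with a show "T \<in> Aut"
    by (auto simp: Aut_def T conjugation_apply alg.assoc)
qed

lemma
  assumes "T \<in> Aut"
  shows Aut_mult: "blinfun_apply T (x \<odot> y) = blinfun_apply T x \<odot> blinfun_apply T y"
    and Aut_one: "blinfun_apply T alg_one = alg_one"
    and Aut_inj: "inj (blinfun_apply T)"
  using assms unfolding Aut_def by (simp_all only: mem_Collect_eq bij_is_inj)

lemma mat_one_neq_zero: "mat 1 \<noteq> (0 :: 'n::finite hmat)"
  by (auto simp: vec_eq_iff mat_def)

subsection \<open>Square roots\<close>

abbreviation alg_diag :: "quat \<Rightarrow> 'n::finite alg" where
  "alg_diag q \<equiv> (mat q, mat q)"

lemma sqrts_minus_one_eq_orbit:
  "sqrts_minus_one = (\<lambda>T. blinfun_apply T (alg_diag qI)) ` (Inn :: ('n::finite alg \<Rightarrow>\<^sub>L 'n alg) set)"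
proof
  have qI: "alg_diag qI \<odot> alg_diag qI = - (alg_one :: 'n alg)"
    by (simp add: alg_mult_def alg_one_def mat_mult_mat uminus_mat quat_units_mult)
  then show "(\<lambda>T. blinfun_apply T (alg_diag qI)) ` (Inn :: ('n alg \<Rightarrow>\<^sub>L 'n alg) set) \<subseteq> sqrts_minus_one"
    using Inn_subset_Aut
    by (auto simp: sqrts_minus_one_def Aut_one blinfun.minus_right simp flip: Aut_mult)
  show "sqrts_minus_one \<subseteq> (\<lambda>T. blinfun_apply T (alg_diag qI)) ` (Inn :: ('n alg \<Rightarrow>\<^sub>L 'n alg) set)"
  proof
    fix x :: "'n alg" assume "x \<in> sqrts_minus_one"
    then have "fst x ** fst x = - mat 1" "snd x ** snd x = - mat 1"
      by (auto simp: sqrts_minus_one_def alg_mult_def alg_one_def prod_eq_iff)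
    then obtain P Q where P: "P \<in> hmat.units" "fst x ** P = P ** mat qI"
      and Q: "Q \<in> hmat.units" "snd x ** Q = Q ** mat qI"
      using sqrt_conjugate_mat_qI by metis
    have u: "(P, Q) \<in> alg.units"
      using P Q by (simp add: alg_units_eq)
    \<comment> \<open>\<open>conjugation a\<close> has the inverse of \<open>a\<close> on the left,
      so the conjugating element is the inverse of \<open>(P, Q)\<close>.\<close>
    have inv: "alg.inv_of (P, Q) \<in> alg.units" "alg.inv_of (alg.inv_of (P, Q)) = (P, Q)"
      using u by (auto intro!: alg.unitsI [of _ "(P, Q)"] alg.inv_of_eqI simp: alg.inverses_def)
    have "x \<odot> (P, Q) = (P, Q) \<odot> alg_diag qI"
      using P Q by (simp add: alg_mult_def)
    then have "x = (P, Q) \<odot> alg_diag qI \<odot> alg.inv_of (P, Q)"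
      using u by (metis alg.assoc alg.e_right alg.inv_of_right)
    also have "\<dots> = blinfun_apply (conjugation (alg.inv_of (P, Q))) (alg_diag qI)"
      by (simp add: conjugation_apply inv)
    finally show "x \<in> (\<lambda>T. blinfun_apply T (alg_diag qI)) ` Inn"
      using inv by (auto simp: Inn_eq)
  qed
qed

text \<open>Reduces assertions invariant under automorphisms to computations with the constant
  diagonal matrices \<open>i\<close>, \<open>j\<close>, \<open>k\<close>.\<close>

lemma sqrts_minus_one_obtain:
  assumes "p \<in> sqrts_minus_one"
  obtains T where "T \<in> Aut" "p = blinfun_apply T (alg_diag qI)"
  using assms Inn_subset_Aut unfolding sqrts_minus_one_eq_orbit by blast

lemma connected_sqrts_minus_one: "connected (sqrts_minus_one :: 'n::finite alg set)"
  unfolding sqrts_minus_one_eq_orbit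
  by (intro connected_continuous_image connected_Inn continuous_intros)

lemma smooth_submanifold_sqrts_minus_one:
  "smooth_submanifold (4 * CARD('n)\<^sup>2) (sqrts_minus_one :: 'n::finite alg set)"
  unfolding sqrts_minus_one_def
proof (rule alg.smooth_submanifold_sqrts)
  fix p :: "'n alg" assume p: "p \<odot> p = - alg_one"
  then have "p \<in> sqrts_minus_one" by (simp add: sqrts_minus_one_def)
  then obtain T where T: "T \<in> Aut" "p = blinfun_apply T (alg_diag qI)"
    by (rule sqrts_minus_one_obtain)
  then have mult: "blinfun_apply T (x \<odot> y) = blinfun_apply T x \<odot> blinfun_apply T y"
    and one: "blinfun_apply T alg_one = alg_one" for x y
    by (simp_all only: Aut_mult Aut_one)
  \<comment> \<open>The image of \<open>j\<close> is a unit anticommuting with \<open>p\<close>, as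
    \<open>dim_anticommutant\<close> demands.\<close>
  define q where "q = blinfun_apply T (alg_diag qJ)"
  have "alg_diag qJ \<odot> alg_diag qI = - (alg_diag qI \<odot> alg_diag qJ :: 'n alg)"
    by (simp add: alg_mult_def mat_mult_mat quat_units_mult uminus_mat)
  then have "q \<odot> p = - (p \<odot> q)"
    unfolding q_def T(2) mult [symmetric] by (simp only: blinfun.minus_right)
  moreover have "alg_diag qJ \<odot> alg_diag qJ = - (alg_one :: 'n alg)"
    by (simp add: alg_mult_def alg_one_def mat_mult_mat quat_units_mult uminus_mat)
  then have "q \<odot> q = - alg_one"
    unfolding q_def mult [symmetric] by (simp only: blinfun.minus_right one)
  then have "q \<in> alg.units"
    by (intro alg.unitsI [of _ "- q"])
      (simp add: alg.inverses_def alg.mul.minus_left alg.mul.minus_right)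
  ultimately have "2 * dim {u. u \<odot> p = - (p \<odot> u)} = DIM('n alg)"
    by (intro alg.dim_anticommutant p)
  then show "dim {u. u \<odot> p = - (p \<odot> u)} = 4 * CARD('n)\<^sup>2"
    by (simp add: power2_eq_square)
qed

section \<open>Center, commutators and the forms Scal and Spec\<close>

lemma alg_center_Int_commutators:
  fixes z :: "'n::finite alg"
  assumes z: "z \<in> alg_center" "z \<in> alg_commutators"
  shows "z = 0"
proof -
  have "fst z ** X = X ** fst z" "snd z ** X = X ** snd z" for X
    using z(1) by (auto simp: alg_center_def alg_mult_def dest: spec [of _ "(X, X)"])
  then obtain s t where st: "fst z = s *\<^sub>R mat 1" "snd z = t *\<^sub>R mat 1"
    using hmat_center by metis
  \<comment> \<open>The real trace vanishes on commutators, but multiplies the scalar of a central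
    component by \<open>CARD('n)\<close>.\<close>
  have "retrace (fst z) = 0 \<and> retrace (snd z) = 0"
    using z(2) unfolding alg_commutators_def
  proof (induction rule: span_induct_alt)
    case base
    show ?case by (simp add: retrace_def)
  next
    case (step c x y)
    then obtain u v where x: "x = u \<odot> v - v \<odot> u" by blast
    have "retrace (fst x) = 0" "retrace (snd x) = 0"
      using retrace_mult_commute [of "fst u" "fst v"] retrace_mult_commute [of "snd u" "snd v"]
      by (simp_all add: x alg_mult_def linear_diff [OF linear_retrace])
    with step show ?case
      by (simp add: linear_add [OF linear_retrace] linear_cmul [OF linear_retrace])
  qed
  moreover have "retrace (r *\<^sub>R (mat 1 :: 'n hmat)) = CARD('n) * r" for r :: real
    by (simp add: retrace_def mat_def)
  ultimately show ?thesis
    using st by (simp add: prod_eq_iff)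
qed

lemma sqrts_minus_one_in_commutators:
  assumes "x \<in> sqrts_minus_one"
  shows "x \<in> alg_commutators"
proof -
  obtain T where T: "T \<in> Aut" "x = blinfun_apply T (alg_diag qI)"
    using assms by (rule sqrts_minus_one_obtain)
  have "x = (1/2) *\<^sub>R blinfun_apply T (alg_diag qJ \<odot> alg_diag qK - alg_diag qK \<odot> alg_diag qJ)"
    unfolding T(2) blinfun.scaleR_right [symmetric]
    by (simp add: alg_mult_def mat_mult_mat quat_units_mult flip: uminus_mat scaleR_2)
  also have "\<dots> = (1/2) *\<^sub>R (blinfun_apply T (alg_diag qJ) \<odot> blinfun_apply T (alg_diag qK)
      - blinfun_apply T (alg_diag qK) \<odot> blinfun_apply T (alg_diag qJ))"
    using T(1) by (simp only: Aut_mult blinfun.diff_right)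
  also have "\<dots> \<in> alg_commutators"
    unfolding alg_commutators_def by (intro span_scale span_base) blast
  finally show ?thesis .
qed

lemma
  fixes x :: "'a::finite alg"
  assumes "x \<in> sqrts_minus_one"
  shows Scal_sqrts_minus_one: "Scal x = 0" and Spec_sqrts_minus_one: "Spec x = 0"
proof -
  have "center_proj x = 0"
    unfolding center_proj_def
  \<comment> \<open>Zero fits the description since \<open>x\<close> is itself in the span of the
    commutators; uniqueness is the trivial intersection with the center.\<close>
  proof (rule the_equality)
    show "0 \<in> alg_center \<and> x - 0 \<in> alg_commutators"
      using sqrts_minus_one_in_commutators [OF assms]
      by (simp add: alg_center_def alg.mul.zero_left alg.mul.zero_right)
    fix z assume z: "z \<in> alg_center \<and> x - z \<in> alg_commutators"
    then have "x - (x - z) \<in> alg_commutators"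
      using sqrts_minus_one_in_commutators [OF assms] unfolding alg_commutators_def
      by (blast intro: span_diff)
    with z show "z = 0"
      by (intro alg_center_Int_commutators) auto
  qed
  moreover have "0 = s *\<^sub>R (alg_one :: 'a alg) + t *\<^sub>R alg_omega \<longleftrightarrow> s = 0 \<and> t = 0" for s t
  proof
    assume "0 = s *\<^sub>R alg_one + t *\<^sub>R (alg_omega :: 'a alg)"
    then have "(s + t) *\<^sub>R (mat 1 :: 'a hmat) = 0" "(s - t) *\<^sub>R (mat 1 :: 'a hmat) = 0"
      by (simp_all add: prod_eq_iff alg_one_def alg_omega_def scaleR_left_distrib
          scaleR_left_diff_distrib)
    then show "s = 0 \<and> t = 0" by (simp add: mat_one_neq_zero)
  qed simp
  ultimately show "Scal x = 0" "Spec x = 0"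
    by (auto simp: Scal_def Spec_def)
qed

subsection \<open>Automorphisms\<close>

lemma Aut_in_Inn:
  fixes T :: "'n::finite alg \<Rightarrow>\<^sub>L 'n alg"
  assumes T: "T \<in> Aut" and nz: "fst (blinfun_apply T (mat 1, 0)) \<noteq> 0"
  shows "T \<in> Inn"
proof -
  have mult: "blinfun_apply T (x \<odot> y) = blinfun_apply T x \<odot> blinfun_apply T y" for x y
    by (rule Aut_mult [OF T])
  have inj: "inj (blinfun_apply T)"
    by (rule Aut_inj [OF T])
  \<comment> \<open>The four blocks of \<open>T\<close>. The two ideals annihilate each other, so
    once a diagonal block is unital, an off-diagonal one vanishes.\<close>
  define f g h k where "f x = fst (blinfun_apply T (x, 0))" and "g x = snd (blinfun_apply T (x, 0))"
    and "h y = fst (blinfun_apply T (0, y))" and "k y = snd (blinfun_apply T (0, y))" for x y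
  have lin: "linear f" "linear k"
    unfolding f_def k_def
    by (auto intro!: linearI simp flip: fst_add snd_add fst_scaleR snd_scaleR blinfun.add_right
        blinfun.scaleR_right)
  have "blinfun_apply T ((x, 0) \<odot> (x', 0)) = blinfun_apply T (x ** x', 0)" 
    "blinfun_apply T ((0, x) \<odot> (0, x')) = blinfun_apply T (0, x ** x')" 
    "blinfun_apply T ((x, 0) \<odot> (0, x')) = 0" for x x'
    by (simp_all add: alg_mult_def hmat.mul.zero_left hmat.mul.zero_right blinfun.zero_right
        flip: zero_prod_def)
  then have m: "f (x ** x') = f x ** f x'" "k (x ** x') = k x ** k x'" 
      "f x ** h x' = 0" "g x ** k x' = 0" for x x'
    unfolding mult by (simp_all add: f_def g_def h_def k_def alg_mult_def prod_eq_iff)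
  obtain P where P: "P \<in> hmat.units" "\<And>x. f x = P ** x ** hmat.inv_of P"
    using hmat_endomorphism_inner [OF lin(1) m(1)] nz by (auto simp: f_def)
  then have "f (mat 1) = mat 1" by simp
  with m(3) [of "mat 1"] have h: "h y = 0" for y by simp
  \<comment> \<open>Otherwise, \<open>h\<close> being zero, \<open>T\<close> would kill
    \<open>(0, mat 1)\<close>.\<close>
  have "k (mat 1) \<noteq> 0"
  proof
    assume "k (mat 1) = 0"
    with h [of "mat 1"] have "blinfun_apply T (0, mat 1) = blinfun_apply T 0"
      by (simp add: h_def k_def prod_eq_iff blinfun.zero_right)
    then show False
      using inj by (simp add: inj_eq mat_one_neq_zero zero_prod_def)
  qed
  then obtain Q where Q: "Q \<in> hmat.units" "\<And>x. k x = Q ** x ** hmat.inv_of Q"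
    using hmat_endomorphism_inner [OF lin(2) m(2)] by auto
  then have "k (mat 1) = mat 1" by simp
  with m(4) [of _ "mat 1"] have g: "g x = 0" for x by simp
  have "blinfun_apply T x = (P, Q) \<odot> x \<odot> (hmat.inv_of P, hmat.inv_of Q)" for x
  proof -
    have "blinfun_apply T x = blinfun_apply T (fst x, 0) + blinfun_apply T (0, snd x)"
      by (simp flip: blinfun.add_right)
    also have "\<dots> = (f (fst x) + h (snd x), g (fst x) + k (snd x))"
      by (simp add: f_def g_def h_def k_def prod_eq_iff)
    finally show ?thesis
      by (simp add: g h P Q alg_mult_def)
  qed
  with P Q show ?thesis
    unfolding Inn_def by (auto simp: alg_mult_def alg_one_def intro!: exI)
qed

definition swap_blinfun :: "'n::finite alg \<Rightarrow>\<^sub>L 'n alg" where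
  "swap_blinfun = Blinfun prod.swap"

lemma swap_blinfun_apply: "blinfun_apply swap_blinfun x = (snd x, fst x)"
  unfolding swap_blinfun_def prod.swap_def
  by (subst bounded_linear_Blinfun_apply) (auto intro!: bounded_linear_intros)

lemma swap_swap: "swap_blinfun o\<^sub>L (swap_blinfun o\<^sub>L T) = T"
  by (rule blinfun_eqI) (simp add: swap_blinfun_apply)

lemma swap_comp_in_Aut: "T \<in> Aut \<Longrightarrow> swap_blinfun o\<^sub>L T \<in> Aut"
proof -
  assume T: "T \<in> Aut"
  have "bij (blinfun_apply (swap_blinfun :: 'a alg \<Rightarrow>\<^sub>L 'a alg))"
    by (rule o_bij [where g = "blinfun_apply swap_blinfun"]) (auto simp: swap_blinfun_apply)
  with T have "bij (blinfun_apply (swap_blinfun o\<^sub>L T))"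
    unfolding blinfun_apply_blinfun_compose [abs_def] by (auto simp: Aut_def intro: bij_comp [unfolded comp_def])
  moreover have "blinfun_apply (swap_blinfun o\<^sub>L T) (x \<odot> y)
      = blinfun_apply (swap_blinfun o\<^sub>L T) x \<odot> blinfun_apply (swap_blinfun o\<^sub>L T) y" for x y
    by (simp add: swap_blinfun_apply Aut_mult [OF T]) (simp add: alg_mult_def)
  moreover have "blinfun_apply (swap_blinfun o\<^sub>L T) alg_one = alg_one"
    by (simp add: swap_blinfun_apply Aut_one [OF T]) (simp add: alg_one_def)
  ultimately show ?thesis
    by (simp only: Aut_def mem_Collect_eq simp_thms)
qed

text \<open>If the first component of the image of \<open>(mat 1, 0)\<close> vanishes, the second
  does not, by injectivity; then \<open>Aut_in_Inn\<close> applies after a swap.\<close>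

lemma Aut_eq: "Aut = Inn \<union> (\<lambda>T. swap_blinfun o\<^sub>L T) ` (Inn :: ('n::finite alg \<Rightarrow>\<^sub>L 'n alg) set)"
proof
  show "Inn \<union> (\<lambda>T. swap_blinfun o\<^sub>L T) ` Inn \<subseteq> (Aut :: ('n alg \<Rightarrow>\<^sub>L 'n alg) set)"
    using Inn_subset_Aut swap_comp_in_Aut by blast
  show "Aut \<subseteq> Inn \<union> (\<lambda>T. swap_blinfun o\<^sub>L T) ` (Inn :: ('n alg \<Rightarrow>\<^sub>L 'n alg) set)"
  proof
    fix T :: "'n alg \<Rightarrow>\<^sub>L 'n alg" assume T: "T \<in> Aut"
    show "T \<in> Inn \<union> (\<lambda>T. swap_blinfun o\<^sub>L T) ` Inn"
    proof (cases "fst (blinfun_apply T (mat 1, 0)) = 0")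
      case False
      with T show ?thesis by (blast intro: Aut_in_Inn)
    next
      case True
      have "blinfun_apply T (mat 1, 0) \<noteq> blinfun_apply T 0"
        using Aut_inj [OF T] by (simp add: inj_eq mat_one_neq_zero zero_prod_def)
      with True have "snd (blinfun_apply T (mat 1, 0)) \<noteq> 0"
        by (auto simp: prod_eq_iff blinfun.zero_right)
      then have "swap_blinfun o\<^sub>L T \<in> Inn"
        by (intro Aut_in_Inn swap_comp_in_Aut T) (simp add: swap_blinfun_apply)
      then show ?thesis
        by (metis UnI2 image_eqI swap_swap)
    qed
  qed
qed

section \<open>Connected components of the automorphism group\<close>

lemma Inn_omega: "T \<in> Inn \<Longrightarrow> blinfun_apply T alg_omega = alg_omega"
  by (auto simp: Inn_def alg_mult_def alg_one_def alg_omega_def hmat.mul.minus_left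
      hmat.mul.minus_right)

lemma alg_omega_neq: "alg_omega \<noteq> - (alg_omega :: 'n::finite alg)"
  by (auto simp: alg_omega_def vec_eq_iff mat_def quat_eq_iff)

text \<open>A connected subset has a connected image in \<open>{a, b}\<close>, hence lies on one
  side; so \<open>A\<close> and \<open>B\<close> are maximal connected subsets.\<close>

lemma components_Un_separated:
  fixes A B :: "'a::topological_space set" and f :: "'a \<Rightarrow> 'b::metric_space"
  assumes "connected A" "connected B" "A \<noteq> {}" "B \<noteq> {}"
    and f: "continuous_on (A \<union> B) f" "f ` A = {a}" "f ` B = {b}" "a \<noteq> b"
  shows "components (A \<union> B) = {A, B}"
proof -
  have fA: "f x = a" if "x \<in> A" for x
    using that f(2) by auto
  have fB: "f x = b" if "x \<in> B" for x
    using that f(3) by auto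
  have sub: "D \<subseteq> A \<or> D \<subseteq> B" if D: "D \<subseteq> A \<union> B" "connected D" for D
  proof -
    have conn: "connected (f ` D)"
      by (rule connected_continuous_image [OF continuous_on_subset [OF f(1) D(1)] D(2)])
    have "f ` D \<subseteq> {a, b}"
      using D(1) fA fB by auto
    then have "finite (f ` D)"
      by (rule finite_subset) simp
    then have "f ` D = {} \<or> (\<exists>c. f ` D = {c})"
      using connected_finite_iff_sing [OF conn] by simp
    then have "f x = f y" if "x \<in> D" "y \<in> D" for x y
      using that by (metis empty_iff imageI singletonD)
    then show ?thesis
      using D(1) fA fB \<open>a \<noteq> b\<close> by (metis UnE subsetD subsetI)
  qed
  have disj: "A \<inter> B = {}"
    using fA fB \<open>a \<noteq> b\<close> by auto
  have maxA: "A \<in> components (A \<union> B)"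
    unfolding in_components_maximal
  proof (intro conjI allI impI)
    fix D assume D: "D \<noteq> {} \<and> A \<subseteq> D \<and> D \<subseteq> A \<union> B \<and> connected D"
    then show "D = A" using sub [of D] disj \<open>A \<noteq> {}\<close> by auto
  qed (use assms in auto)
  have maxB: "B \<in> components (A \<union> B)"
    unfolding in_components_maximal
  proof (intro conjI allI impI)
    fix D assume D: "D \<noteq> {} \<and> B \<subseteq> D \<and> D \<subseteq> A \<union> B \<and> connected D"
    then show "D = B" using sub [of D] disj \<open>B \<noteq> {}\<close> by auto
  qed (use assms in auto)
  have "C = A \<or> C = B" if C: "C \<in> components (A \<union> B)" for C
  proof -
    have "C \<inter> A \<noteq> {} \<or> C \<inter> B \<noteq> {}"
      using in_components_nonempty [OF C] in_components_subset [OF C] by auto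
    then show ?thesis
      using components_eq [OF C maxA] components_eq [OF C maxB] by auto
  qed
  with maxA maxB show ?thesis by auto
qed

text \<open>Evaluation at the central element \<open>alg_omega\<close> is the separating map: inner
  automorphisms fix it, their swaps negate it.\<close>

lemma components_Aut:
  "components Aut = {Inn, (\<lambda>T. swap_blinfun o\<^sub>L T) ` (Inn :: ('n::finite alg \<Rightarrow>\<^sub>L 'n alg) set)}"
  unfolding Aut_eq
proof (rule components_Un_separated)
  have swap_omega: "blinfun_apply swap_blinfun alg_omega = - alg_omega"
    by (simp add: swap_blinfun_apply alg_omega_def)
  show "connected ((\<lambda>T. swap_blinfun o\<^sub>L T) ` (Inn :: ('n alg \<Rightarrow>\<^sub>L 'n alg) set))"
    by (intro connected_continuous_image connected_Inn continuous_intros)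
  show "(\<lambda>T. blinfun_apply T alg_omega) ` (Inn :: ('n alg \<Rightarrow>\<^sub>L 'n alg) set) = {alg_omega}"
    using id_in_Inn by (force simp: Inn_omega)
  show "(\<lambda>T. blinfun_apply T alg_omega) `
      ((\<lambda>T. swap_blinfun o\<^sub>L T) ` (Inn :: ('n alg \<Rightarrow>\<^sub>L 'n alg) set)) = {- alg_omega}"
    using id_in_Inn by (force simp: Inn_omega swap_omega image_image)
qed (use id_in_Inn in \<open>auto intro!: continuous_intros connected_Inn simp: alg_omega_neq\<close>)

theorem mainTheorem4:
  shows "(sqrts_minus_one :: 'n::finite alg set) \<in> conjugacy_classes \<and>
    connected (sqrts_minus_one :: 'n alg set) \<and>
    smooth_submanifold (4 * CARD('n)\<^sup>2) (sqrts_minus_one :: 'n alg set) \<and>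
    DIM('n alg) = 2 * (4 * CARD('n)\<^sup>2) \<and>
    (\<forall>f f'. (f, f') \<in> (sqrts_minus_one :: 'n alg set) \<longrightarrow> Scal (f, f') = 0 \<and> Spec (f, f') = 0) \<and>
    (\<exists>C. components (Aut :: ('n alg \<Rightarrow>\<^sub>L 'n alg) set) = {Inn, C} \<and> C \<noteq> Inn \<and>
         connected_component_set Aut (id_blinfun :: 'n alg \<Rightarrow>\<^sub>L 'n alg) = Inn \<and>
         (\<exists>\<sigma>\<in>C. \<forall>f f'. blinfun_apply \<sigma> (f, f') = (f', f)))"
proof (intro conjI exI allI impI)
  show "(sqrts_minus_one :: 'n alg set) \<in> conjugacy_classes"
    unfolding conjugacy_classes_def sqrts_minus_one_eq_orbit by blast
  show "DIM('n alg) = 2 * (4 * CARD('n)\<^sup>2)"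
    by (simp add: power2_eq_square)
  show "components Aut = {Inn, (\<lambda>T. swap_blinfun o\<^sub>L T) ` (Inn :: ('n alg \<Rightarrow>\<^sub>L 'n alg) set)}"
    by (rule components_Aut)
  have swap: "swap_blinfun \<in> (\<lambda>T. swap_blinfun o\<^sub>L T) ` (Inn :: ('n alg \<Rightarrow>\<^sub>L 'n alg) set)"
    using id_in_Inn by (force intro: blinfun_eqI)
  moreover have "swap_blinfun \<notin> (Inn :: ('n alg \<Rightarrow>\<^sub>L 'n alg) set)"
    using Inn_omega [of swap_blinfun] alg_omega_neq
    by (auto simp: swap_blinfun_apply alg_omega_def)
  ultimately show "(\<lambda>T. swap_blinfun o\<^sub>L T) ` (Inn :: ('n alg \<Rightarrow>\<^sub>L 'n alg) set) \<noteq> Inn"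
    by metis
  show "connected_component_set Aut (id_blinfun :: 'n alg \<Rightarrow>\<^sub>L 'n alg) = Inn"
  proof -
    have "Inn \<in> components (Aut :: ('n alg \<Rightarrow>\<^sub>L 'n alg) set)"
      by (simp add: components_Aut)
    then obtain T :: "'n alg \<Rightarrow>\<^sub>L 'n alg" where T: "Inn = connected_component_set Aut T"
      by (auto simp: components_iff)
    with id_in_Inn have "id_blinfun \<in> connected_component_set Aut T" by simp
    then show ?thesis
      unfolding T by (rule connected_component_eq)
  qed
  show "\<exists>\<sigma>\<in>(\<lambda>T. swap_blinfun o\<^sub>L T) ` Inn. \<forall>f f'. blinfun_apply \<sigma> (f, f') = (f', f :: 'n hmat)"
    by (rule bexI [OF _ swap]) (simp add: swap_blinfun_apply)
qed (simp_all add: connected_sqrts_minus_one smooth_submanifold_sqrts_minus_one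
    Scal_sqrts_minus_one Spec_sqrts_minus_one)

end
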